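(* Let $A$ be a (not necessarily unital) C*-algebra, let $Z(M(A))$ be the center of its multiplier algebra $M(A)$, and let $X$ be a full (left) Hilbert $A$-module. Let $T: X \to X$ be a bijective bounded $A$-module morphism such that every norm-closed $A$-submodule $Y \subseteq X$ is invariant under $T$, i.e. $T(Y) \subseteq Y$. Then there exists an invertible element $d \in Z(M(A))$ such that $T = d \cdot \mathrm{id}_X$, i.e. $T(x) = d x$ for all $x \in X$.
   Context: A (left) Hilbert $A$-module is a complex vector space $X$ which is a left $A$-module with compatible complex-linear structures, equipped with a map $\langle \cdot,\cdot\rangle : X \times X \to A$ that is $A$-linear in the first and conjugate-$A$-linear in the second variable and satisfies $\langle x,y\rangle = \langle y,x\rangle^*$, $\langle x,x\rangle \ge 0$, and $\langle x,x\rangle = 0$ iff $x=0$, and which is complete in the norm $\|x\| = \|\langle x,x\rangle\|_A^{1/2}$. It is full if the norm-closure of the linear hull of $\{\langle x,y\rangle : x,y\in X\}$ equals $A$. An $A$-submodule is a complex-linear subspace $Y$ with $aY \subseteq Y$ for all $a \in A$. A bounded module morphism is a bounded linear map $T$ with $T(ax)=aT(x)$ for all $a\in A$, $x\in X$ (adjointability is not assumed). The $A$-action on $X$ extends canonically to an action of $M(A)$, which is how $d \in Z(M(A))$ acts on $X$. *)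

theory Defs
  imports "HOL-Analysis.Analysis"
begin

section \<open>Complex normed spaces and C*-algebras\<close>

class scaleC =
  fixes scaleC :: "complex \<Rightarrow> 'a \<Rightarrow> 'a" (infixr "*\<^sub>C" 75)

text \<open>The real structure, which carries the topology and bounded linear maps of the library, is
  the restriction of the complex one.\<close>

class complex_normed_vector = real_normed_vector + scaleC +
  assumes scaleC_of_real: "complex_of_real r *\<^sub>C x = r *\<^sub>R x"
    and scaleC_add_right: "c *\<^sub>C (x + y) = c *\<^sub>C x + c *\<^sub>C y"
    and scaleC_add_left: "(c + d) *\<^sub>C x = c *\<^sub>C x + d *\<^sub>C x"
    and scaleC_scaleC: "c *\<^sub>C d *\<^sub>C x = (c * d) *\<^sub>C x"
    and norm_scaleC: "norm (c *\<^sub>C x) = cmod c * norm x"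

global_interpretation complex_vector:
  vector_space "scaleC :: complex \<Rightarrow> 'a \<Rightarrow> 'a::complex_normed_vector"
proof
  fix x :: 'a
  show "1 *\<^sub>C x = x"
    using scaleC_of_real[of 1 x] by simp
qed (rule scaleC_add_right scaleC_add_left scaleC_scaleC)+

definition bounded_clinear ::
  "('a::complex_normed_vector \<Rightarrow> 'b::complex_normed_vector) \<Rightarrow> bool" where
  "bounded_clinear f \<longleftrightarrow> bounded_linear f \<and> (\<forall>c x. f (c *\<^sub>C x) = c *\<^sub>C f x)"

text \<open>A type without a unit, so that non-unital algebras are covered; the zero algebra is
  covered too.\<close>

class cstar_algebra = complex_normed_vector + real_normed_algebra + banach +
  fixes star :: "'a \<Rightarrow> 'a"
  assumes mult_scaleC_left: "(c *\<^sub>C a) * b = c *\<^sub>C (a * b)"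
    and mult_scaleC_right: "a * (c *\<^sub>C b) = c *\<^sub>C (a * b)"
    and star_star: "star (star a) = a"
    and star_add: "star (a + b) = star a + star b"
    and star_scaleC: "star (c *\<^sub>C a) = cnj c *\<^sub>C star a"
    and star_mult: "star (a * b) = star b * star a"
    and cstar_identity: "norm (star a * a) = (norm a)\<^sup>2"

definition positive :: "'a::cstar_algebra \<Rightarrow> bool" where
  "positive a \<longleftrightarrow> (\<exists>b. a = star b * b)"


section \<open>The multiplier algebra\<close>

text \<open>Multipliers of \<open>A\<close> are the double centralizers \<open>(L, R)\<close>; a multiplier \<open>m\<close> is to be thought of
  as acting by \<open>L a = m a\<close> and \<open>R a = a m\<close>.\<close>

definition double_centralizer ::
  "('a::cstar_algebra \<Rightarrow> 'a) \<Rightarrow> ('a \<Rightarrow> 'a) \<Rightarrow> bool" where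
  "double_centralizer L R \<longleftrightarrow> bounded_clinear L \<and> bounded_clinear R \<and>
     (\<forall>a b. L (a * b) = L a * b) \<and> (\<forall>a b. R (a * b) = a * R b) \<and>
     (\<forall>a b. a * L b = R a * b)"

lemma bounded_clinear_id: "bounded_clinear (\<lambda>x. x)"
  by (simp add: bounded_clinear_def bounded_linear_ident)

lemma bounded_clinear_zero: "bounded_clinear (\<lambda>x. 0)"
  by (simp add: bounded_clinear_def bounded_linear_zero)

lemma bounded_clinear_add:
  "bounded_clinear f \<Longrightarrow> bounded_clinear g \<Longrightarrow> bounded_clinear (\<lambda>x. f x + g x)"
  by (simp add: bounded_clinear_def bounded_linear_add scaleC_add_right)

lemma bounded_clinear_minus:
  "bounded_clinear f \<Longrightarrow> bounded_clinear (\<lambda>x. - f x)"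
  by (simp add: bounded_clinear_def bounded_linear_minus)

lemma bounded_clinear_sub:
  "bounded_clinear f \<Longrightarrow> bounded_clinear g \<Longrightarrow> bounded_clinear (\<lambda>x. f x - g x)"
  by (simp add: bounded_clinear_def bounded_linear_sub complex_vector.scale_right_diff_distrib)

lemma bounded_clinear_compose:
  "bounded_clinear f \<Longrightarrow> bounded_clinear g \<Longrightarrow> bounded_clinear (\<lambda>x. f (g x))"
  by (simp add: bounded_clinear_def bounded_linear_compose)

typedef (overloaded) 'a multiplier =
  "{(L, R). double_centralizer (L :: 'a::cstar_algebra \<Rightarrow> 'a) R}"
proof
  show "(\<lambda>x. 0, \<lambda>x. 0) \<in> {(L, R). double_centralizer (L :: 'a \<Rightarrow> 'a) R}"
    by (simp add: double_centralizer_def bounded_clinear_zero)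
qed

setup_lifting type_definition_multiplier

text \<open>\<open>lmult m a\<close> is \<open>m a\<close> and \<open>rmult m a\<close> is \<open>a m\<close>.\<close>

lift_definition lmult :: "'a::cstar_algebra multiplier \<Rightarrow> 'a \<Rightarrow> 'a" is fst .
lift_definition rmult :: "'a::cstar_algebra multiplier \<Rightarrow> 'a \<Rightarrow> 'a" is snd .

text \<open>The order of composition is reversed in the second component.  Since the zero algebra has
  \<open>0 = 1\<close> in its multiplier algebra, the class \<open>ring_1\<close> is not available.\<close>

instantiation multiplier :: (cstar_algebra) "{ring, monoid_mult}"
begin

lift_definition zero_multiplier :: "'a multiplier" is "(\<lambda>x. 0, \<lambda>x. 0)"
  by (simp add: double_centralizer_def bounded_clinear_zero)

lift_definition one_multiplier :: "'a multiplier" is "(\<lambda>x. x, \<lambda>x. x)"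
  by (simp add: double_centralizer_def bounded_clinear_id)

lift_definition plus_multiplier :: "'a multiplier \<Rightarrow> 'a multiplier \<Rightarrow> 'a multiplier"
  is "\<lambda>(L, R) (L', R'). (\<lambda>x. L x + L' x, \<lambda>x. R x + R' x)"
  by (auto simp: double_centralizer_def bounded_clinear_add algebra_simps)

lift_definition uminus_multiplier :: "'a multiplier \<Rightarrow> 'a multiplier"
  is "\<lambda>(L, R). (\<lambda>x. - L x, \<lambda>x. - R x)"
  by (auto simp: double_centralizer_def bounded_clinear_minus)

lift_definition minus_multiplier :: "'a multiplier \<Rightarrow> 'a multiplier \<Rightarrow> 'a multiplier"
  is "\<lambda>(L, R) (L', R'). (\<lambda>x. L x - L' x, \<lambda>x. R x - R' x)"
  by (auto simp: double_centralizer_def bounded_clinear_sub algebra_simps)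

lift_definition times_multiplier :: "'a multiplier \<Rightarrow> 'a multiplier \<Rightarrow> 'a multiplier"
  is "\<lambda>(L, R) (L', R'). (\<lambda>x. L (L' x), \<lambda>x. R' (R x))"
  by (auto simp: double_centralizer_def bounded_clinear_compose)

instance
  by standard
    (transfer; auto simp: double_centralizer_def bounded_clinear_def linear_simps algebra_simps)+

end

definition multiplier_center :: "'a::cstar_algebra multiplier set" where
  "multiplier_center = {d. \<forall>m. d * m = m * d}"


section \<open>Hilbert modules\<close>

text \<open>The norm of the ambient Banach space is required to be the one induced by the inner product,
  so completeness refers to the latter.  Conjugate linearity in the second variable follows from
  linearity in the first one together with \<open>ip_star\<close>; see below.\<close>

locale hilbert_module =
  fixes act :: "'a::cstar_algebra \<Rightarrow> 'x::{complex_normed_vector, banach} \<Rightarrow> 'x"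
    and ip :: "'x \<Rightarrow> 'x \<Rightarrow> 'a"
  assumes act_add_left: "act (a + b) x = act a x + act b x"
    and act_add_right: "act a (x + y) = act a x + act a y"
    and act_mult: "act (a * b) x = act a (act b x)"
    and act_scaleC_left: "act (c *\<^sub>C a) x = c *\<^sub>C act a x"
    and act_scaleC_right: "act a (c *\<^sub>C x) = c *\<^sub>C act a x"
    and ip_add_left: "ip (x + y) z = ip x z + ip y z"
    and ip_scaleC_left: "ip (c *\<^sub>C x) y = c *\<^sub>C ip x y"
    and ip_act_left: "ip (act a x) y = a * ip x y"
    and ip_star: "ip x y = star (ip y x)"
    and ip_positive: "positive (ip x x)"
    and ip_eq_0_iff: "ip x x = 0 \<longleftrightarrow> x = 0"
    and norm_eq_sqrt_ip: "norm x = sqrt (norm (ip x x))"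
begin

lemma ip_add_right: "ip x (y + z) = ip x y + ip x z"
  by (metis ip_star ip_add_left star_add)

lemma ip_scaleC_right: "ip x (c *\<^sub>C y) = cnj c *\<^sub>C ip x y"
  by (metis ip_star ip_scaleC_left star_scaleC)

lemma ip_act_right: "ip x (act a y) = ip x y * star a"
  by (metis ip_star ip_act_left star_mult)

end

definition full_ip :: "('x \<Rightarrow> 'x \<Rightarrow> 'a::cstar_algebra) \<Rightarrow> bool" where
  "full_ip ip \<longleftrightarrow> closure (complex_vector.span {ip x y | x y. True}) = UNIV"

definition is_submodule ::
  "('a::cstar_algebra \<Rightarrow> 'x::complex_normed_vector \<Rightarrow> 'x) \<Rightarrow> 'x set \<Rightarrow> bool" where
  "is_submodule act Y \<longleftrightarrow> complex_vector.subspace Y \<and> (\<forall>a. \<forall>y\<in>Y. act a y \<in> Y)"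

definition bounded_module_morphism ::
  "('a::cstar_algebra \<Rightarrow> 'x::complex_normed_vector \<Rightarrow> 'x) \<Rightarrow> ('x \<Rightarrow> 'x) \<Rightarrow> bool" where
  "bounded_module_morphism act T \<longleftrightarrow>
     bounded_clinear T \<and> (\<forall>a x. T (act a x) = act a (T x))"

text \<open>The canonical extension of the action to the multiplier algebra: \<open>m\<close> acts as the unique
  bounded operator that maps \<open>a x\<close> to \<open>(m a) x\<close>.  On a Hilbert module this operator exists by an
  approximate unit argument and is unique because the elements \<open>a x\<close> are total.\<close>

definition multiplier_act ::
  "('a::cstar_algebra \<Rightarrow> 'x::complex_normed_vector \<Rightarrow> 'x) \<Rightarrow> 'a multiplier \<Rightarrow> 'x \<Rightarrow> 'x" where
  "multiplier_act act m =
     (THE S. bounded_clinear S \<and> (\<forall>a x. S (act a x) = act (lmult m a) x))"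

end

theory Submission
  imports Defs
begin

text \<open>Let \<open>I\<close> be a maximal left ideal of the unitization of \<open>A\<close>.  For \<open>g \<in> X\<close> the set of all \<open>z\<close>
  with \<open>\<langle>z, g\<rangle> \<in> I\<close> is a closed submodule, hence invariant under \<open>T\<close>, so \<open>T\<close> induces an endomorphism
  of the simple module \<open>A/I\<close>.  By Schur and Gelfand--Mazur it is a scalar, and the scalar does not
  depend on \<open>g\<close>.  Consequently \<open>\<langle>z, x\<rangle>\<langle>T y, w\<rangle> - \<langle>T z, x\<rangle>\<langle>y, w\<rangle>\<close> lies in every maximal left ideal, and
  therefore vanishes, which gives the exchange identity \<open>\<langle>z, x\<rangle> T y = \<langle>T z, x\<rangle> y\<close>.  The assignment
  \<open>\<langle>z, x\<rangle> \<mapsto> \<langle>T z, x\<rangle>\<close> thus determines a bounded bimodule map on a dense ideal, whose extension to \<open>A\<close>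
  is a central multiplier that implements \<open>T\<close>.  The exchange identity passes to \<open>T\<^sup>-\<^sup>1\<close>, which is
  bounded, and yields the inverse multiplier.\<close>

section \<open>Complex Banach algebras and the unitization\<close>

text \<open>The obstacle is that \<open>I\<close> is only a left ideal and that \<open>T\<close>
  need not have an adjoint. A congruence modulo \<open>I\<close> cannot be multiplied from the
  right, so the product \<open>ip (T z) x * ip y w\<close> is read as a single inner product of
  \<open>T z\<close> with another vector; this is why one scalar has to serve all \<open>g\<close>.
  Adjoining a unit puts every proper left ideal inside a maximal one and makes the maximal ones
  closed. The copy of \<open>A\<close> in its unitization is one of these ideals; modulo it all
  inner products vanish and any scalar works. Gelfand--Mazur and the vanishing of elements common to
  all maximal left ideals rest on one estimate: if \<open>1 - l *\<^sub>C b\<close> is invertible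
  modulo null elements for every \<open>l\<close>, then \<open>\<rho> ^ n * p (b ^ n)\<close> tends
  to 0 for every \<open>\<rho>\<close>. In the quotient this contradicts the existence of an inverse
  of \<open>b\<close>; in the algebra it contradicts \<open>norm (embed h ^ n) = norm h ^ n\<close>
  for selfadjoint \<open>h\<close>.\<close>

class complex_banach_algebra_1 = complex_normed_vector + real_normed_algebra_1 + banach +
  assumes scaleC_mult_left: "(c *\<^sub>C a) * b = c *\<^sub>C (a * b)"
    and scaleC_mult_right: "a * (c *\<^sub>C b) = c *\<^sub>C (a * b)"

lemma scaleC_diff_right:
  "c *\<^sub>C (x - y) = c *\<^sub>C x - c *\<^sub>C (y :: 'a::complex_normed_vector)"
  by (rule complex_vector.scale_right_diff_distrib)

text \<open>A unit is adjoined even to a unital \<open>A\<close>. The sum norm chosen below is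
  complete and submultiplicative; the C*-identity is invoked only for elements of
  \<open>A\<close>.\<close>

datatype 'a unitization = Unitization (scalar_part: complex) (algebra_part: 'a)

instantiation unitization :: (cstar_algebra) "{complex_normed_vector, real_normed_algebra_1}"
begin

definition "0 = Unitization 0 0"
definition "1 = Unitization 1 0"
definition "x + y = Unitization (scalar_part x + scalar_part y) (algebra_part x + algebra_part y)"
definition "- x = Unitization (- scalar_part x) (- algebra_part x)"
definition "x - y = Unitization (scalar_part x - scalar_part y) (algebra_part x - algebra_part y)"
definition "x * y = Unitization (scalar_part x * scalar_part y)
   (scalar_part x *\<^sub>C algebra_part y + scalar_part y *\<^sub>C algebra_part x
      + algebra_part x * algebra_part y)"
definition "r *\<^sub>R x = Unitization (r *\<^sub>R scalar_part x) (r *\<^sub>R algebra_part x)"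
definition "c *\<^sub>C x = Unitization (c * scalar_part x) (c *\<^sub>C algebra_part x)"
definition "norm x = cmod (scalar_part x) + norm (algebra_part x)"
definition "sgn (x :: 'a unitization) = inverse (norm x) *\<^sub>R x"
definition "dist (x :: 'a unitization) y = norm (x - y)"
definition [code del]: "(uniformity :: ('a unitization \<times> 'a unitization) filter) =
   (INF e\<in>{0<..}. principal {(x, y). dist x y < e})"
definition [code del]: "open (U :: 'a unitization set) \<longleftrightarrow>
   (\<forall>x\<in>U. eventually (\<lambda>(x', y). x' = x \<longrightarrow> y \<in> U) uniformity)"

lemmas unitization_arith_defs = zero_unitization_def one_unitization_def plus_unitization_def
  uminus_unitization_def minus_unitization_def times_unitization_def scaleR_unitization_def
  scaleC_unitization_def

instance
proof
  fix x y z :: "'a unitization" and r s :: real and c d :: complex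
  show "x + y + z = x + (y + z)" "x + y = y + x" "0 + x = x" "- x + x = 0" "x - y = x + - y"
    by (simp_all add: unitization_arith_defs algebra_simps)
  show "r *\<^sub>R (x + y) = r *\<^sub>R x + r *\<^sub>R y" "(r + s) *\<^sub>R x = r *\<^sub>R x + s *\<^sub>R x"
    "r *\<^sub>R s *\<^sub>R x = (r * s) *\<^sub>R x" "1 *\<^sub>R x = x"
    by (simp_all add: unitization_arith_defs algebra_simps)
  show "complex_of_real r *\<^sub>C x = r *\<^sub>R x"
    by (simp add: unitization_arith_defs scaleC_of_real scaleR_conv_of_real)
  show "c *\<^sub>C (x + y) = c *\<^sub>C x + c *\<^sub>C y" "(c + d) *\<^sub>C x = c *\<^sub>C x + d *\<^sub>C x"
    "c *\<^sub>C d *\<^sub>C x = (c * d) *\<^sub>C x"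
    by (simp_all add: unitization_arith_defs scaleC_add_right scaleC_add_left scaleC_scaleC
        algebra_simps)
  show "x * y * z = x * (y * z)" "1 * x = x" "x * 1 = x"
    "(x + y) * z = x * z + y * z" "x * (y + z) = x * y + x * z"
    by (simp_all add: unitization_arith_defs scaleC_add_right scaleC_add_left scaleC_scaleC
        mult_scaleC_left mult_scaleC_right algebra_simps)
  show "r *\<^sub>R x * y = r *\<^sub>R (x * y)" "x * r *\<^sub>R y = r *\<^sub>R (x * y)"
    by (simp_all add: unitization_arith_defs scaleC_add_right scaleC_add_left scaleC_scaleC
        scaleC_of_real[symmetric] mult_scaleC_left mult_scaleC_right algebra_simps
        scaleR_conv_of_real)
  show "(0 :: 'a unitization) \<noteq> 1"
    by (simp add: unitization_arith_defs)
  show "norm (1 :: 'a unitization) = 1"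
    by (simp add: norm_unitization_def one_unitization_def)
  show "norm x = 0 \<longleftrightarrow> x = 0"
    by (cases x) (simp add: norm_unitization_def zero_unitization_def add_nonneg_eq_0_iff)
  show "norm (x + y) \<le> norm x + norm y"
    using norm_triangle_ineq[of "scalar_part x" "scalar_part y"]
      norm_triangle_ineq[of "algebra_part x" "algebra_part y"]
    by (simp add: norm_unitization_def plus_unitization_def)
  show "norm (r *\<^sub>R x) = \<bar>r\<bar> * norm x"
    by (simp add: norm_unitization_def scaleR_unitization_def algebra_simps)
  show "norm (c *\<^sub>C x) = cmod c * norm x"
    by (simp add: norm_unitization_def scaleC_unitization_def norm_mult norm_scaleC algebra_simps)
  have "norm (algebra_part (x * y)) \<le> cmod (scalar_part x) * norm (algebra_part y)
      + cmod (scalar_part y) * norm (algebra_part x) + norm (algebra_part x) * norm (algebra_part y)"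
    unfolding times_unitization_def unitization.sel
    by (intro norm_triangle_mono) (auto simp: norm_scaleC norm_mult_ineq)
  then show "norm (x * y) \<le> norm x * norm y"
    by (simp add: norm_unitization_def norm_mult times_unitization_def algebra_simps)
  show "sgn x = inverse (norm x) *\<^sub>R x" "dist x y = norm (x - y)"
    by (simp_all add: sgn_unitization_def dist_unitization_def)
  show "(uniformity :: ('a unitization \<times> 'a unitization) filter) =
      (INF e\<in>{0<..}. principal {(x, y). dist x y < e})"
    by (simp add: uniformity_unitization_def)
  show "open U \<longleftrightarrow> (\<forall>x\<in>U. eventually (\<lambda>(x', y). x' = x \<longrightarrow> y \<in> U) uniformity)"
    for U :: "'a unitization set"
    by (simp add: open_unitization_def)
qed

end

instance unitization :: (cstar_algebra) complex_banach_algebra_1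
proof
  fix x y :: "'a unitization" and c :: complex
  show "(c *\<^sub>C x) * y = c *\<^sub>C (x * y)" "x * (c *\<^sub>C y) = c *\<^sub>C (x * y)"
    by (simp_all add: unitization_arith_defs scaleC_add_right scaleC_add_left scaleC_scaleC
        mult_scaleC_left mult_scaleC_right algebra_simps)
next
  fix X :: "nat \<Rightarrow> 'a unitization"
  assume X: "Cauchy X"
  have le: "dist (scalar_part x) (scalar_part y) \<le> dist x y"
    "dist (algebra_part x) (algebra_part y) \<le> dist x y" for x y :: "'a unitization"
    by (simp_all add: dist_norm dist_unitization_def norm_unitization_def minus_unitization_def)
  have "Cauchy (\<lambda>n. scalar_part (X n))" "Cauchy (\<lambda>n. algebra_part (X n))"
    using X unfolding Cauchy_def by (meson le le_less_trans)+
  then obtain s a where "(\<lambda>n. scalar_part (X n)) \<longlonglongrightarrow> s" "(\<lambda>n. algebra_part (X n)) \<longlonglongrightarrow> a"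
    using Cauchy_convergent convergent_def by meson
  then have "(\<lambda>n. dist (scalar_part (X n)) s + dist (algebra_part (X n)) a) \<longlonglongrightarrow> 0 + 0"
    by (intro tendsto_add) (simp_all add: tendsto_dist_iff[symmetric])
  then have "(\<lambda>n. dist (X n) (Unitization s a)) \<longlonglongrightarrow> 0"
    by (simp add: dist_norm dist_unitization_def norm_unitization_def minus_unitization_def)
  then show "convergent X"
    using tendsto_dist_iff convergent_def by blast
qed

section \<open>Quasinilpotency from everywhere defined resolvents\<close>

lemma sum_powers_mult: "(\<Sum>k<n. x ^ k) * (1 - x) = 1 - (x :: 'a::ring_1) ^ n"
proof (induction n)
  case (Suc n)
  have "(\<Sum>k<Suc n. x ^ k) * (1 - x) = (\<Sum>k<n. x ^ k) * (1 - x) + x ^ n * (1 - x)"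
    by (simp only: sum.lessThan_Suc distrib_right)
  also have "\<dots> = 1 - x ^ Suc n"
    unfolding Suc.IH by (simp add: right_diff_distrib power_commutes)
  finally show ?case .
qed simp

lemma scaleC_power: "(c *\<^sub>C x) ^ n = c ^ n *\<^sub>C (x :: 'a::complex_banach_algebra_1) ^ n"
  by (induction n) (simp_all add: scaleC_mult_left scaleC_mult_right scaleC_scaleC)

text \<open>Averaging a polynomial of degree below \<open>n\<close> over the \<open>n\<close>-th
  roots of unity leaves only its constant term: every other power contributes a geometric sum over a
  nontrivial root of unity.\<close>

lemma sum_powers_root_of_unity:
  assumes "0 < k" "k < n"
  shows "(\<Sum>j<n. (cis (2 * pi / n) ^ j) ^ k) = 0"
proof -
  let ?z = "cis (2 * pi * k / n)"
  have pow: "(cis (2 * pi / n) ^ j) ^ k = ?z ^ j" for j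
    by (simp add: Complex.DeMoivre mult_ac)
  have "?z \<noteq> cis (2 * pi * real 0 / n)"
  proof
    assume "?z = cis (2 * pi * real 0 / n)"
    from inj_onD[OF bij_betw_imp_inj_on[OF Complex.bij_betw_roots_unity[of n]] this] show False
      using assms by simp
  qed
  then have ne: "?z \<noteq> 1"
    by simp
  have "real n * (2 * pi * k / n) = 2 * pi * real k"
    using assms by simp
  then have "?z ^ n = 1"
    by (simp only: Complex.DeMoivre cis_multiple_2pi[OF Ints_of_nat])
  then have "(\<Sum>j<n. ?z ^ j) * (1 - ?z) = 0"
    by (simp add: sum_powers_mult)
  then show ?thesis
    using ne by (simp add: pow)
qed

text \<open>This stands for the normed algebra \<open>D\<close> modulo the kernel of
  \<open>p\<close>; identities in the quotient are written as \<open>p (...) = 0\<close>. The two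
  instances are the whole algebra with its norm and the idealizer of a left ideal with the distance
  to that ideal.\<close>

locale algebra_seminorm =
  fixes D :: "'b::complex_banach_algebra_1 set" and p :: "'b \<Rightarrow> real"
  assumes one_mem: "1 \<in> D"
    and add_mem: "x \<in> D \<Longrightarrow> y \<in> D \<Longrightarrow> x + y \<in> D"
    and mult_mem: "x \<in> D \<Longrightarrow> y \<in> D \<Longrightarrow> x * y \<in> D"
    and scaleC_mem: "x \<in> D \<Longrightarrow> c *\<^sub>C x \<in> D"
    and p_add: "x \<in> D \<Longrightarrow> y \<in> D \<Longrightarrow> p (x + y) \<le> p x + p y"
    and p_scaleC: "p (c *\<^sub>C x) = cmod c * p x"
    and p_mult: "x \<in> D \<Longrightarrow> y \<in> D \<Longrightarrow> p (x * y) \<le> p x * p y"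
begin

lemma minus_mem: "x \<in> D \<Longrightarrow> - x \<in> D"
  using scaleC_mem[of x "-1"] by simp

lemma diff_mem: "x \<in> D \<Longrightarrow> y \<in> D \<Longrightarrow> x - y \<in> D"
  using add_mem[of x "- y"] minus_mem by simp

lemma zero_mem: "0 \<in> D"
  using diff_mem[OF one_mem one_mem] by simp

lemma power_mem: "x \<in> D \<Longrightarrow> x ^ n \<in> D"
  by (induction n) (simp_all add: one_mem mult_mem)

lemma sum_mem: "(\<And>i. i \<in> A \<Longrightarrow> f i \<in> D) \<Longrightarrow> sum f A \<in> D"
  by (induction A rule: infinite_finite_induct) (simp_all add: zero_mem add_mem)

lemmas mem = one_mem add_mem mult_mem scaleC_mem minus_mem diff_mem zero_mem power_mem sum_mem

lemma p_zero: "p 0 = 0"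
  using p_scaleC[of 0 0] by simp

lemma p_minus: "p (- x) = p x"
  using p_scaleC[of "-1" x] by simp

lemma p_diff: "x \<in> D \<Longrightarrow> y \<in> D \<Longrightarrow> p (x - y) \<le> p x + p y"
  using p_add[of x "- y"] by (simp add: minus_mem p_minus)

lemma p_nonneg: "x \<in> D \<Longrightarrow> 0 \<le> p x"
  using p_diff[of x x] by (simp add: p_zero)

lemma p_sum: "(\<And>i. i \<in> A \<Longrightarrow> f i \<in> D) \<Longrightarrow> p (sum f A) \<le> (\<Sum>i\<in>A. p (f i))"
proof (induction A rule: infinite_finite_induct)
  case (insert x A)
  then have "p (f x + sum f A) \<le> p (f x) + p (sum f A)"
    by (intro p_add mem) auto
  then show ?case
    using insert by force
qed (simp_all add: p_zero)

lemma p_null_mult: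
  assumes "x \<in> D" "y \<in> D" "p x = 0 \<or> p y = 0"
  shows "p (x * y) = 0"
  using p_mult[OF assms(1,2)] p_nonneg[OF mult_mem[OF assms(1,2)]] assms(3) by auto

lemma p_null_diff:
  assumes "x \<in> D" "y \<in> D" "p x = 0" "p y = 0"
  shows "p (x - y) = 0"
  using p_diff[OF assms(1,2)] p_nonneg[OF diff_mem[OF assms(1,2)]] assms(3,4) by auto

lemma p_null_sum:
  assumes "\<And>i. i \<in> A \<Longrightarrow> f i \<in> D" "\<And>i. i \<in> A \<Longrightarrow> p (f i) = 0"
  shows "p (sum f A) = 0"
proof (rule antisym)
  have "p (sum f A) \<le> (\<Sum>i\<in>A. p (f i))"
    by (rule p_sum[OF assms(1)])
  also have "\<dots> = 0"
    by (rule sum.neutral) (simp add: assms(2))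
  finally show "p (sum f A) \<le> 0" .
  show "0 \<le> p (sum f A)"
    by (rule p_nonneg[OF sum_mem[OF assms(1)]])
qed

lemma p_le_if_null_diff:
  assumes "x \<in> D" "y \<in> D" "p (x - y) = 0"
  shows "p x \<le> p y"
  using p_add[of "x - y" y] assms by (simp add: diff_mem)

text \<open>Rickart's argument.  The averages of the resolvent over the \<open>n\<close>-th roots of unity invert
  \<open>1 - t\<^sup>n b\<^sup>n\<close> and are Lipschitz in \<open>t\<close>, uniformly in \<open>n\<close>.  Hence convergence of \<open>t\<^sup>n b\<^sup>n\<close> to \<open>0\<close>
  propagates from \<open>t\<close> to \<open>t + \<delta>/2\<close> with a \<open>\<delta>\<close> that does not depend on \<open>t\<close>.\<close>

lemma power_tendsto_zero_if_resolvent: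
  assumes b: "b \<in> D"
    and inv: "\<And>l. \<exists>c\<in>D. p (c * (1 - l *\<^sub>C b) - 1) = 0 \<and> p ((1 - l *\<^sub>C b) * c - 1) = 0"
    and "0 \<le> \<rho>"
  shows "(\<lambda>n. \<rho> ^ n * p (b ^ n)) \<longlonglongrightarrow> 0"
proof -
  define w where "w l = 1 - l *\<^sub>C b" for l
  have w: "w l \<in> D" for l
    unfolding w_def by (intro mem b)
  obtain R where R: "R l \<in> D" and left: "p (R l * w l - 1) = 0" and right: "p (w l * R l - 1) = 0"
    for l
    using inv unfolding w_def by metis
  note mem' = mem w R b
  have p0: "0 \<le> p (R l)" "0 \<le> p b" for l
    by (simp_all add: p_nonneg mem')
  \<comment> \<open>The resolvent identity, which holds only up to the defects of \<open>R l\<close>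
    as a left inverse and of \<open>R m\<close> as a right inverse.\<close>
  have res: "p (R l - R m) \<le> cmod (l - m) * (p (R l) * p b * p (R m))" for l m
  proof -
    have "R l - R m - (l - m) *\<^sub>C (R l * b * R m)
        = (R l * w l - 1) * R m - R l * (w m * R m - 1)"
      by (simp add: w_def algebra_simps scaleC_mult_left scaleC_mult_right
          complex_vector.scale_left_diff_distrib)
    also have "p \<dots> = 0"
      by (intro p_null_diff p_null_mult mem' disjI1 disjI2 left right)
    finally have "p (R l - R m) \<le> p ((l - m) *\<^sub>C (R l * b * R m))"
      by (intro p_le_if_null_diff mem')
    also have "\<dots> = cmod (l - m) * p (R l * b * R m)"
      by (rule p_scaleC)
    also have "p (R l * b * R m) \<le> p (R l) * p b * p (R m)"
      by (rule order_trans[OF p_mult mult_right_mono[OF p_mult]]) (intro mem' p0)+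
    finally show ?thesis
      by (simp add: mult_left_mono)
  qed
  \<comment> \<open>The extra room lets the grid overshoot \<open>\<rho>\<close> by up to
    \<open>1 / 2\<close> while the look-ahead by \<open>\<delta>\<close> stays inside the disc on
    which \<open>R\<close> is bounded.\<close>
  define r where "r = \<rho> + 1"
  have r: "r \<ge> 1"
    using \<open>0 \<le> \<rho>\<close> by (simp add: r_def)
  obtain K where K: "K \<ge> 1" "\<And>l. cmod l \<le> r \<Longrightarrow> p (R l) \<le> K"
  proof -
    \<comment> \<open>Within this radius the resolvent identity gives
      \<open>p (R m) \<le> p (R l) + p (R m) / 2\<close>. Compactness of the disc turns these local
      bounds into \<open>K\<close>.\<close>
    define d where "d l = 1 / (2 * (p (R l) * p b + 1))" for l
    have d: "d l > 0" for l
      using p0 by (simp add: d_def add_nonneg_pos)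
    have near: "p (R m) \<le> 2 * p (R l)" if "m \<in> ball l (d l)" for l m
    proof -
      have "p (R m) \<le> p (R l) + p (R m - R l)"
        using p_add[of "R l" "R m - R l"] by (simp add: mem')
      also have "p (R m - R l) \<le> cmod (m - l) * (p (R l) * p b) * p (R m)"
        using res[of m l] by (simp add: mult_ac)
      also have "cmod (m - l) * (p (R l) * p b) \<le> d l * (p (R l) * p b + 1)"
        using that p0 by (intro mult_mono) (auto simp: dist_norm norm_minus_commute d less_imp_le)
      also have "d l * (p (R l) * p b + 1) = 1 / 2"
      proof -
        have "p (R l) * p b + 1 > 0"
          using p0 by (simp add: add_nonneg_pos)
        then show ?thesis
          by (simp add: d_def divide_simps)
      qed
      finally show ?thesis
        by (simp add: p0 mult_right_mono)
    qed
    have "compact (cball (0::complex) r)"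
      by simp
    then obtain F where F: "F \<subseteq> cball 0 r" "finite F" "cball 0 r \<subseteq> (\<Union>l\<in>F. ball l (d l))"
    proof (rule compactE_image[of _ "cball 0 r" "\<lambda>l. ball l (d l)"])
      show "cball 0 r \<subseteq> (\<Union>l\<in>cball 0 r. ball l (d l))"
        using d by (auto intro!: bexI)
    qed auto
    show ?thesis
    proof
      show "1 + (\<Sum>l\<in>F. 2 * p (R l)) \<ge> 1"
        by (simp add: sum_nonneg p0)
      show "p (R m) \<le> 1 + (\<Sum>l\<in>F. 2 * p (R l))" if "cmod m \<le> r" for m
      proof -
        have "m \<in> (\<Union>l\<in>F. ball l (d l))"
          using that by (intro subsetD[OF F(3)]) simp
        then obtain l where l: "l \<in> F" "m \<in> ball l (d l)"
          by (rule UN_E)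
        have "p (R m) \<le> 2 * p (R l)"
          using near l(2) .
        also have "\<dots> \<le> (\<Sum>l\<in>F. 2 * p (R l))"
          by (rule member_le_sum[OF l(1)]) (auto simp: F p0)
        finally show ?thesis
          by simp
      qed
    qed
  qed
  define L where "L = K * p b * K"
  have L: "L \<ge> 0"
    using K p0 by (simp add: L_def)
  have lip: "p (R l - R m) \<le> cmod (l - m) * L" if "cmod l \<le> r" "cmod m \<le> r" for l m
  proof -
    have "p (R l) * p b * p (R m) \<le> L"
      unfolding L_def using K that p0 by (intro mult_mono) auto
    then show ?thesis
      using res[of l m] by (meson mult_left_mono norm_ge_zero order_trans)
  qed
  define \<omega> where "\<omega> n = cis (2 * pi / real n)" for n :: nat
  define F where "F n t = (1 / of_nat n) *\<^sub>C (\<Sum>j<n. R (\<omega> n ^ j * of_real t))" for n :: nat and t :: real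
  have cmod: "cmod (\<omega> n ^ j * of_real t) = \<bar>t\<bar>" for n j t
    by (simp add: \<omega>_def norm_mult norm_power)
  have F: "F n t \<in> D" for n t
    unfolding F_def by (intro mem')
  have pF: "p (F n t) \<le> K" if "n > 0" "\<bar>t\<bar> \<le> r" for n t
  proof -
    have "p (\<Sum>j<n. R (\<omega> n ^ j * of_real t)) \<le> (\<Sum>j<n. K)"
      by (rule order_trans[OF p_sum sum_mono]) (use that in \<open>auto simp: mem' cmod intro!: K\<close>)
    then show ?thesis
      using that by (simp add: F_def p_scaleC norm_divide field_simps)
  qed
  have Flip: "p (F n t - F n s) \<le> \<bar>t - s\<bar> * L" if "n > 0" "\<bar>t\<bar> \<le> r" "\<bar>s\<bar> \<le> r" for n t s
  proof -
    have *: "p (R (\<omega> n ^ j * of_real t) - R (\<omega> n ^ j * of_real s)) \<le> \<bar>t - s\<bar> * L" for j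
    proof -
      have "cmod (\<omega> n ^ j * of_real t - \<omega> n ^ j * of_real s) = \<bar>t - s\<bar>"
        using cmod[of n j "t - s"] by (simp add: algebra_simps)
      then show ?thesis
        using lip[of "\<omega> n ^ j * of_real t" "\<omega> n ^ j * of_real s"] that by (simp add: cmod)
    qed
    have "p (\<Sum>j<n. R (\<omega> n ^ j * of_real t) - R (\<omega> n ^ j * of_real s)) \<le> (\<Sum>j<n. \<bar>t - s\<bar> * L)"
      by (rule order_trans[OF p_sum sum_mono]) (auto simp: mem' *)
    moreover have "F n t - F n s
        = (1 / of_nat n) *\<^sub>C (\<Sum>j<n. R (\<omega> n ^ j * of_real t) - R (\<omega> n ^ j * of_real s))"
      by (simp add: F_def sum_subtractf scaleC_diff_right)
    ultimately show ?thesis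
      using that by (simp add: p_scaleC norm_divide field_simps)
  qed
  define z where "z n t = of_real (t ^ n) *\<^sub>C b ^ n" for n and t :: real
  have z: "z n t \<in> D" for n t
    unfolding z_def by (intro mem')
  have pz: "p (z n t) = \<bar>t\<bar> ^ n * p (b ^ n)" for n t
    by (simp add: z_def p_scaleC norm_power)
  have Finv: "p (F n t - z n t * F n t - 1) = 0" if n: "n > 0" for n t
  proof -
    \<comment> \<open>Each truncated geometric series satisfies
      \<open>S j * w (...) = 1 - z n t\<close>, and the \<open>S j\<close> average to
      \<open>1\<close>. Multiplying the defects of the right inverses by \<open>S j\<close> and
      averaging therefore makes \<open>F n t\<close> a right inverse of \<open>1 - z n t\<close>
      modulo null elements.\<close>
    define x where "x j = (\<omega> n ^ j * of_real t) *\<^sub>C b" for j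
    define S where "S j = (\<Sum>k<n. x j ^ k)" for j
    have S: "S j \<in> D" for j
      unfolding S_def x_def by (intro mem')
    have xn: "x j ^ n = z n t" for j
    proof -
      have "\<omega> n ^ n = 1"
        using n by (simp add: \<omega>_def Complex.DeMoivre)
      then have "(\<omega> n ^ j) ^ n = 1"
        by (metis power_mult mult.commute power_one)
      then show ?thesis
        by (simp add: x_def scaleC_power z_def power_mult_distrib)
    qed
    have Sj: "S j * w (\<omega> n ^ j * of_real t) = 1 - z n t" for j
      using sum_powers_mult[of "x j" n] by (simp add: S_def w_def x_def[symmetric] xn)
    have "(\<Sum>j<n. S j) = (\<Sum>k<n. \<Sum>j<n. x j ^ k)"
      unfolding S_def by (rule sum.swap)
    also have "\<dots> = (\<Sum>k<n. ((\<Sum>j<n. (\<omega> n ^ j) ^ k) * of_real (t ^ k)) *\<^sub>C b ^ k)"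
      by (simp add: x_def scaleC_power power_mult_distrib sum_distrib_right complex_vector.scale_sum_left)
    also have "\<dots> = (\<Sum>k<n. if k = 0 then of_nat n *\<^sub>C 1 else 0)"
      by (rule sum.cong) (auto simp: \<omega>_def sum_powers_root_of_unity)
    also have "\<dots> = of_nat n *\<^sub>C 1"
      using n by simp
    finally have sumS: "(\<Sum>j<n. S j) = of_nat n *\<^sub>C 1" .
    define E where
      "E = (\<Sum>j<n. S j * (w (\<omega> n ^ j * of_real t) * R (\<omega> n ^ j * of_real t) - 1))"
    have "p E = 0"
      unfolding E_def by (intro p_null_sum p_null_mult mem' S disjI2 right)
    have "E = (\<Sum>j<n. (1 - z n t) * R (\<omega> n ^ j * of_real t) - S j)"
      unfolding E_def by (simp add: right_diff_distrib mult.assoc[symmetric] Sj)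
    also have "\<dots> = (1 - z n t) * (\<Sum>j<n. R (\<omega> n ^ j * of_real t)) - of_nat n *\<^sub>C 1"
      by (simp add: sum_subtractf sum_distrib_left sumS)
    finally have "(1 / of_nat n) *\<^sub>C E = (1 - z n t) * F n t - 1"
      using n by (simp add: F_def scaleC_diff_right scaleC_mult_right scaleC_scaleC)
    then have "F n t - z n t * F n t - 1 = (1 / of_nat n) *\<^sub>C E"
      by (simp add: left_diff_distrib)
    then show ?thesis
      by (simp only: p_scaleC \<open>p E = 0\<close> mult_zero_right)
  qed
  \<comment> \<open>Moving \<open>t\<close> by \<open>\<delta>\<close> changes \<open>F\<close> by
    at most \<open>1 / 8\<close>; with the \<open>1 / 8\<close> allowed at \<open>t\<close> itself
    this keeps \<open>p (?G - 1)\<close> at most \<open>1 / 4\<close>.\<close>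
  define \<delta> where "\<delta> = 1 / (8 * (L + 1))"
  have \<delta>: "\<delta> > 0" "\<delta> \<le> 1 / 2" "\<delta> * L \<le> 1 / 8"
    using L by (auto simp: \<delta>_def field_simps)
  define u where "u t n = t ^ n * p (b ^ n)" for t :: real and n
  have u0: "u t n \<ge> 0" if "t \<ge> 0" for t n
    using that by (simp add: u_def p_nonneg mem')
  have step: "u (t + \<delta> / 2) \<longlonglongrightarrow> 0" if t: "t \<ge> 0" "t + \<delta> \<le> r" and lim: "u t \<longlonglongrightarrow> 0" for t
  proof -
    have le1: "u (t + \<delta>) n \<le> 1" if n: "n > 0" and small: "u t n * K \<le> 1 / 8" for n
    proof -
      let ?F = "F n t" and ?G = "F n (t + \<delta>)" and ?z = "z n (t + \<delta>)"
      have "p (?F - 1) \<le> p (z n t * ?F)"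
        using Finv[OF n, of t] by (intro p_le_if_null_diff mem' F z) (simp add: algebra_simps)
      also have "\<dots> \<le> u t n * K"
      proof -
        have "p (z n t * ?F) \<le> p (z n t) * p ?F"
          by (intro p_mult F z)
        also have "\<dots> \<le> u t n * K"
          using pF[OF n, of t] t \<delta>
          by (simp add: pz u_def mult_left_mono p_nonneg mem')
        finally show ?thesis .
      qed
      finally have "p (?F - 1) \<le> 1 / 8"
        using small by simp
      moreover have "p (?G - ?F) \<le> 1 / 8"
        using Flip[OF n, of "t + \<delta>" t] t \<delta> by simp
      moreover have "p (?G - 1) \<le> p (?G - ?F) + p (?F - 1)"
        using p_add[of "?G - ?F" "?F - 1"] by (simp add: mem' F)
      ultimately have q: "p (?G - 1) \<le> 1 / 4"
        by simp
      \<comment> \<open>Modulo null elements \<open>?z = (?G - 1) - ?z * (?G - 1)\<close>, whence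
        \<open>p ?z \<le> 1 / 4 + p ?z / 4\<close>.\<close>
      have "?z - ((?G - 1) - ?z * (?G - 1)) = - (?G - ?z * ?G - 1)"
        by (simp add: algebra_simps)
      then have "p (?z - ((?G - 1) - ?z * (?G - 1))) = 0"
        using Finv[OF n] by (simp only: p_minus)
      then have "p ?z \<le> p ((?G - 1) - ?z * (?G - 1))"
        by (intro p_le_if_null_diff mem' F z)
      also have "\<dots> \<le> p (?G - 1) + p (?z * (?G - 1))"
        by (intro p_diff mem' F z)
      also have "p (?z * (?G - 1)) \<le> p ?z * p (?G - 1)"
        by (intro p_mult mem' F z)
      also have "p ?z * p (?G - 1) \<le> p ?z * (1 / 4)"
        by (intro mult_left_mono q p_nonneg z)
      finally have "p ?z \<le> 1"
        using q by simp
      then show ?thesis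
        using t \<delta> by (simp add: pz u_def)
    qed
    have "(\<lambda>n. u t n * K) \<longlonglongrightarrow> 0 * K"
      by (intro tendsto_mult lim tendsto_const)
    then have "eventually (\<lambda>n. u t n * K < 1 / 8) sequentially"
      by (auto dest: order_tendstoD(2)[where a = "1 / 8"])
    then have ev: "eventually (\<lambda>n. u (t + \<delta>) n \<le> 1) sequentially"
      using eventually_gt_at_top[of 0] by eventually_elim (use le1 in auto)
    \<comment> \<open>Boundedness at \<open>t + \<delta>\<close> becomes geometric decay at the
      smaller point \<open>t + \<delta> / 2\<close>, which is why only half of the look-ahead is
      gained.\<close>
    define s where "s = (t + \<delta> / 2) / (t + \<delta>)"
    have s: "0 \<le> s" "s < 1" "t + \<delta> / 2 = s * (t + \<delta>)"
      using t \<delta> by (auto simp: s_def)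
    have "(\<lambda>n. s ^ n) \<longlonglongrightarrow> 0"
      using s by (intro LIMSEQ_power_zero) auto
    moreover have "eventually (\<lambda>n. u (t + \<delta> / 2) n \<le> s ^ n) sequentially"
      using ev
    proof eventually_elim
      case (elim n)
      have "u (t + \<delta> / 2) n = s ^ n * u (t + \<delta>) n"
        unfolding s(3) u_def by (simp add: power_mult_distrib)
      also have "\<dots> \<le> s ^ n * 1"
        using elim s by (intro mult_left_mono) auto
      finally show ?case
        by simp
    qed
    moreover have "eventually (\<lambda>n. 0 \<le> u (t + \<delta> / 2) n) sequentially"
      using t \<delta> by (intro always_eventually allI u0) auto
    ultimately show ?thesis
      using tendsto_sandwich[of "\<lambda>_. 0" "u (t + \<delta> / 2)" sequentially "\<lambda>n. s ^ n" 0] by simp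
  qed
  have grid: "u (m * (\<delta> / 2)) \<longlonglongrightarrow> 0" if "m * (\<delta> / 2) \<le> \<rho> + 1 / 2" for m :: nat
    using that
  proof (induction m)
    case 0
    have "eventually (\<lambda>n. u 0 n = 0) sequentially"
      using eventually_gt_at_top[of 0] by eventually_elim (simp add: u_def)
    then show ?case
      by (simp add: tendsto_eventually)
  next
    case (Suc m)
    have "m * (\<delta> / 2) + \<delta> / 2 \<le> \<rho> + 1 / 2"
      using Suc.prems by (simp add: algebra_simps)
    then have "u (m * (\<delta> / 2) + \<delta> / 2) \<longlonglongrightarrow> 0"
      using \<delta> by (intro step Suc.IH) (auto simp: r_def)
    moreover have "real (Suc m) * (\<delta> / 2) = m * (\<delta> / 2) + \<delta> / 2"
      by (simp add: algebra_simps)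
    ultimately show ?case
      by (simp only:)
  qed
  define m where "m = nat \<lceil>\<rho> / (\<delta> / 2)\<rceil>"
  have m0: "real m = of_int \<lceil>\<rho> / (\<delta> / 2)\<rceil>"
    unfolding m_def using \<open>0 \<le> \<rho>\<close> \<delta> by simp
  have "\<rho> / (\<delta> / 2) \<le> m" "m \<le> \<rho> / (\<delta> / 2) + 1"
    unfolding m0 by linarith+
  then have m: "\<rho> \<le> m * (\<delta> / 2)" "m * (\<delta> / 2) \<le> \<rho> + \<delta> / 2"
    using \<delta> by (auto simp: field_simps)
  have lim: "u (m * (\<delta> / 2)) \<longlonglongrightarrow> 0"
    using m \<delta> by (intro grid) auto
  have "u \<rho> n \<le> u (m * (\<delta> / 2)) n" for n
    unfolding u_def using m \<open>0 \<le> \<rho>\<close> by (intro mult_right_mono power_mono p_nonneg mem')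
  then have "u \<rho> \<longlonglongrightarrow> 0"
    using u0[OF \<open>0 \<le> \<rho>\<close>] lim
      tendsto_sandwich[of "\<lambda>_. 0" "u \<rho>" sequentially "u (m * (\<delta> / 2))" 0] by simp
  then show ?thesis
    by (simp add: u_def[abs_def])
qed

end

section \<open>Maximal left ideals\<close>

definition left_ideal :: "'a::ring_1 set \<Rightarrow> bool" where
  "left_ideal I \<longleftrightarrow> 0 \<in> I \<and> (\<forall>x\<in>I. \<forall>y\<in>I. x + y \<in> I) \<and> (\<forall>a. \<forall>x\<in>I. a * x \<in> I)"

definition maximal_left_ideal :: "'a::ring_1 set \<Rightarrow> bool" where
  "maximal_left_ideal I \<longleftrightarrow>
     left_ideal I \<and> 1 \<notin> I \<and> (\<forall>J. left_ideal J \<longrightarrow> 1 \<notin> J \<longrightarrow> I \<subseteq> J \<longrightarrow> J = I)"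

lemma left_idealD:
  assumes "left_ideal I"
  shows "0 \<in> I" "x \<in> I \<Longrightarrow> y \<in> I \<Longrightarrow> x + y \<in> I" "x \<in> I \<Longrightarrow> a * x \<in> I"
    "x \<in> I \<Longrightarrow> - x \<in> I" "x \<in> I \<Longrightarrow> y \<in> I \<Longrightarrow> x - y \<in> I"
proof -
  show *: "0 \<in> I" "\<And>x y. x \<in> I \<Longrightarrow> y \<in> I \<Longrightarrow> x + y \<in> I" "\<And>a x. x \<in> I \<Longrightarrow> a * x \<in> I"
    using assms by (auto simp: left_ideal_def)
  show minus: "- x \<in> I" if "x \<in> I" for x
    using *(3)[OF that, of "- 1"] by simp
  show "x - y \<in> I" if "x \<in> I" "y \<in> I"
    using *(2)[OF that(1) minus[OF that(2)]] by simp
qed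

lemma left_ideal_scaleC:
  fixes x :: "'a::complex_banach_algebra_1"
  assumes "left_ideal I" "x \<in> I"
  shows "c *\<^sub>C x \<in> I"
  using left_idealD(3)[OF assms, of "c *\<^sub>C 1"] by (simp add: scaleC_mult_left)

lemma left_ideal_principal: "left_ideal (range (\<lambda>a. a * x))"
  unfolding left_ideal_def
proof (intro conjI ballI allI)
  show "0 \<in> range (\<lambda>a. a * x)"
    by (rule range_eqI[of _ _ 0]) simp
next
  fix y z assume "y \<in> range (\<lambda>a. a * x)" "z \<in> range (\<lambda>a. a * x)"
  then obtain a b where "y = a * x" "z = b * x"
    by blast
  then show "y + z \<in> range (\<lambda>a. a * x)"
    by (intro range_eqI[of _ _ "a + b"]) (simp add: distrib_right)
next
  fix b y assume "y \<in> range (\<lambda>a. a * x)"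
  then obtain a where "y = a * x"
    by blast
  then show "b * y \<in> range (\<lambda>a. a * x)"
    by (intro range_eqI[of _ _ "b * a"]) (simp add: mult.assoc)
qed

text \<open>Properness in the form \<open>1 \<notin> K\<close> passes to unions of chains, so Zorn's
  lemma applies.\<close>

lemma maximal_left_ideal_exists:
  assumes "left_ideal J" "1 \<notin> J"
  shows "\<exists>I. maximal_left_ideal I \<and> J \<subseteq> I"
proof -
  let ?A = "{K. left_ideal K \<and> 1 \<notin> K \<and> J \<subseteq> K}"
  have "\<exists>M\<in>?A. \<forall>X\<in>?A. M \<subseteq> X \<longrightarrow> X = M"
  proof (rule subset_Zorn_nonempty)
    show "?A \<noteq> {}"
      using assms by blast
    fix C assume "C \<noteq> {}" and C: "subset.chain ?A C"
    then have K: "left_ideal K" "1 \<notin> K" "J \<subseteq> K" if "K \<in> C" for K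
      using that by (auto simp: subset.chain_def)
    have tot: "K \<subseteq> L \<or> L \<subseteq> K" if "K \<in> C" "L \<in> C" for K L
      using C that unfolding subset_chain_def by blast
    have "left_ideal (\<Union>C)"
      unfolding left_ideal_def
    proof (intro conjI ballI allI)
      show "0 \<in> \<Union>C"
        using \<open>C \<noteq> {}\<close> left_idealD(1)[OF K(1)] by blast
    next
      fix x y assume "x \<in> \<Union>C" "y \<in> \<Union>C"
      then obtain L where "L \<in> C" "x \<in> L" "y \<in> L"
        using tot by blast
      then show "x + y \<in> \<Union>C"
        using left_idealD(2)[OF K(1)] by blast
    next
      fix a x assume "x \<in> \<Union>C"
      then show "a * x \<in> \<Union>C"
        using left_idealD(3)[OF K(1)] by blast
    qed
    then show "\<Union>C \<in> ?A"
      using K \<open>C \<noteq> {}\<close> by blast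
  qed
  then obtain M where M: "M \<in> ?A" and max: "\<forall>X\<in>?A. M \<subseteq> X \<longrightarrow> X = M" ..
  from M(1) have M': "left_ideal M" "1 \<notin> M" "J \<subseteq> M"
    by simp_all
  have "K = M" if "left_ideal K" "1 \<notin> K" "M \<subseteq> K" for K
    using bspec[OF max, of K] that M' by auto
  then have "maximal_left_ideal M"
    unfolding maximal_left_ideal_def using M' by simp
  then show ?thesis
    using M'(3) by blast
qed

text \<open>This is the simplicity of the quotient by \<open>I\<close>: the set \<open>?J\<close> is
  the left ideal generated by \<open>x\<close> and \<open>I\<close>, so by maximality it contains
  \<open>1\<close>.\<close>

lemma maximal_left_ideal_cases:
  assumes "maximal_left_ideal I" "x \<notin> I"
  shows "\<exists>a. a * x - 1 \<in> I"
proof (rule ccontr)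
  assume no: "\<nexists>a. a * x - 1 \<in> I"
  note I = left_idealD[OF assms(1)[unfolded maximal_left_ideal_def, THEN conjunct1]]
  let ?J = "{y. \<exists>a. a * x - y \<in> I}"
  have "left_ideal ?J"
    unfolding left_ideal_def
  proof (intro conjI ballI allI)
    show "0 \<in> ?J"
      using I(1) by (auto intro!: exI[of _ 0])
  next
    fix y z assume "y \<in> ?J" "z \<in> ?J"
    then obtain a b where "a * x - y \<in> I" "b * x - z \<in> I"
      by blast
    then have "(a * x - y) + (b * x - z) \<in> I"
      by (rule I)
    then show "y + z \<in> ?J"
      by (auto intro!: exI[of _ "a + b"] simp: algebra_simps)
  next
    fix c y assume "y \<in> ?J"
    then obtain a where "a * x - y \<in> I"
      by blast
    then have "c * (a * x - y) \<in> I"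
      by (rule I)
    then show "c * y \<in> ?J"
      by (auto intro!: exI[of _ "c * a"] simp: algebra_simps)
  qed
  moreover have "1 \<notin> ?J"
    using no by blast
  moreover have "I \<subseteq> ?J"
    using I(4) by (auto intro!: exI[of _ 0])
  ultimately have "?J = I"
    using assms(1) unfolding maximal_left_ideal_def by blast
  moreover have "x \<in> ?J"
    using I(1) by (auto intro!: exI[of _ 1])
  ultimately show False
    using assms(2) by blast
qed

section \<open>Closedness of maximal left ideals and the quotient seminorm\<close>

lemma neumann_inverse:
  fixes e :: "'a::{real_normed_algebra_1, banach}"
  assumes "norm e < 1"
  shows "\<exists>y. y * (1 - e) = 1 \<and> (1 - e) * y = 1"
proof -
  have s: "summable (\<lambda>n. e ^ n)"
    by (rule complete_algebra_summable_geometric[OF assms])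
  have split: "(\<Sum>n. e ^ Suc n) = (\<Sum>n. e ^ n) - 1"
    using suminf_split_head[OF s] by simp
  have "e * (\<Sum>n. e ^ n) = (\<Sum>n. e ^ n) - 1"
    using suminf_mult[OF s, of e] split by simp
  moreover have "(\<Sum>n. e ^ n) * e = (\<Sum>n. e ^ n) - 1"
    using suminf_mult2[OF s, of e] split by (simp add: power_commutes)
  ultimately show ?thesis
    by (intro exI[of _ "\<Sum>n. e ^ n"]) (simp add: algebra_simps)
qed

text \<open>The closure is again a left ideal. It is proper, since an element of \<open>I\<close> at
  distance less than 1 from \<open>1\<close> would be invertible by the Neumann series.\<close>

lemma maximal_left_ideal_closed:
  fixes I :: "'a::{real_normed_algebra_1, banach} set"
  assumes "maximal_left_ideal I"
  shows "closed I"
proof -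
  have I: "left_ideal I" "1 \<notin> I"
    using assms by (simp_all add: maximal_left_ideal_def)
  have "left_ideal (closure I)"
    unfolding left_ideal_def
  proof (intro conjI ballI allI)
    show "0 \<in> closure I"
      using left_idealD(1)[OF I(1)] closure_subset by blast
  next
    fix x y assume "x \<in> closure I" "y \<in> closure I"
    then obtain X Y where "\<And>n. X n \<in> I" "X \<longlonglongrightarrow> x" "\<And>n. Y n \<in> I" "Y \<longlonglongrightarrow> y"
      unfolding closure_sequential by metis
    then show "x + y \<in> closure I"
      unfolding closure_sequential
      by (intro exI[of _ "\<lambda>n. X n + Y n"]) (auto intro: left_idealD(2)[OF I(1)] tendsto_add)
  next
    fix a x assume "x \<in> closure I"
    then obtain X where "\<And>n. X n \<in> I" "X \<longlonglongrightarrow> x"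
      unfolding closure_sequential by metis
    then show "a * x \<in> closure I"
      unfolding closure_sequential
      by (intro exI[of _ "\<lambda>n. a * X n"]) (auto intro: left_idealD(3)[OF I(1)] tendsto_mult)
  qed
  moreover have "1 \<notin> closure I"
  proof
    assume "1 \<in> closure I"
    then obtain i where i: "i \<in> I" "dist i 1 < 1"
      unfolding closure_approachable by (metis zero_less_one)
    then have "norm (1 - i) < 1"
      by (simp add: dist_norm norm_minus_commute)
    then obtain y where "y * (1 - (1 - i)) = 1"
      using neumann_inverse by blast
    then have "y * i = 1"
      by simp
    then show False
      using left_idealD(3)[OF I(1) i(1), of y] I(2) by simp
  qed
  ultimately have "closure I = I"
    using assms closure_subset unfolding maximal_left_ideal_def by blast
  then show ?thesis
    by (metis closed_closure)
qed

lemma infdist_greatest: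
  assumes "A \<noteq> {}" "\<And>a. a \<in> A \<Longrightarrow> C \<le> dist x a"
  shows "C \<le> infdist x A"
  using assms by (auto simp: infdist_notempty intro: cINF_greatest)

lemma infdist_scaleC_le:
  fixes x :: "'a::complex_normed_vector"
  assumes "0 \<in> I" "\<And>x. x \<in> I \<Longrightarrow> c *\<^sub>C x \<in> I"
  shows "infdist (c *\<^sub>C x) I \<le> cmod c * infdist x I"
proof (cases "c = 0")
  case True
  then show ?thesis
    using assms by simp
next
  case False
  have "infdist (c *\<^sub>C x) I / cmod c \<le> dist x i" if "i \<in> I" for i
  proof -
    have "infdist (c *\<^sub>C x) I \<le> dist (c *\<^sub>C x) (c *\<^sub>C i)"
      by (intro infdist_le assms that)
    also have "\<dots> = cmod c * dist x i"
      by (simp add: dist_norm norm_scaleC flip: scaleC_diff_right)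
    finally show ?thesis
      using False by (simp add: field_simps)
  qed
  then have "infdist (c *\<^sub>C x) I / cmod c \<le> infdist x I"
    using assms by (intro infdist_greatest) auto
  then show ?thesis
    using False by (simp add: field_simps)
qed

text \<open>The distance to \<open>I\<close> is the quotient norm. For submultiplicativity expand
  \<open>(x - i) * (y - j)\<close>: all terms but \<open>x * y\<close> lie in \<open>I\<close>, and
  for \<open>i * y\<close> this is exactly the condition that \<open>y\<close> idealizes
  \<open>I\<close>.\<close>

lemma algebra_seminorm_idealizer:
  fixes I :: "'a::complex_banach_algebra_1 set"
  assumes "left_ideal I"
  shows "algebra_seminorm {b. \<forall>i\<in>I. i * b \<in> I} (\<lambda>x. infdist x I)"
proof
  note I = left_idealD[OF assms] left_ideal_scaleC[OF assms]
  have ne: "I \<noteq> {}"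
    using I(1) by blast
  show "1 \<in> {b. \<forall>i\<in>I. i * b \<in> I}"
    by simp
  show "x + y \<in> {b. \<forall>i\<in>I. i * b \<in> I}"
    if "x \<in> {b. \<forall>i\<in>I. i * b \<in> I}" "y \<in> {b. \<forall>i\<in>I. i * b \<in> I}" for x y
    using that by (auto simp: distrib_left intro: I)
  show "x * y \<in> {b. \<forall>i\<in>I. i * b \<in> I}"
    if "x \<in> {b. \<forall>i\<in>I. i * b \<in> I}" "y \<in> {b. \<forall>i\<in>I. i * b \<in> I}" for x y
    using that by (auto simp flip: mult.assoc)
  show "c *\<^sub>C x \<in> {b. \<forall>i\<in>I. i * b \<in> I}" if "x \<in> {b. \<forall>i\<in>I. i * b \<in> I}" for c x
    using that by (auto simp: scaleC_mult_right intro: I)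
  show "infdist (x + y) I \<le> infdist x I + infdist y I" for x y
  proof -
    have "infdist (x + y) I \<le> dist x i + dist y j" if "i \<in> I" "j \<in> I" for i j
      using infdist_le[OF I(2)[OF that], of "x + y"] dist_triangle_add[of x y i j] by linarith
    then have "infdist (x + y) I - dist y j \<le> infdist x I" if "j \<in> I" for j
      using that ne by (intro infdist_greatest) (auto simp: algebra_simps)
    then have "infdist (x + y) I - infdist x I \<le> infdist y I"
      using ne by (intro infdist_greatest) (auto simp: algebra_simps)
    then show ?thesis
      by simp
  qed
  show "infdist (c *\<^sub>C x) I = cmod c * infdist x I" for c x
  proof (cases "c = 0")
    case False
    have "infdist ((1 / c) *\<^sub>C c *\<^sub>C x) I \<le> cmod (1 / c) * infdist (c *\<^sub>C x) I"
      by (intro infdist_scaleC_le I)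
    then have "cmod c * infdist x I \<le> infdist (c *\<^sub>C x) I"
      using False by (simp add: scaleC_scaleC norm_divide field_simps)
    moreover have "infdist (c *\<^sub>C x) I \<le> cmod c * infdist x I"
      by (intro infdist_scaleC_le I)
    ultimately show ?thesis
      by simp
  qed (simp add: I)
  show "infdist (x * y) I \<le> infdist x I * infdist y I"
    if y: "y \<in> {b. \<forall>i\<in>I. i * b \<in> I}" for x y
  proof -
    have *: "infdist (x * y) I \<le> dist x i * dist y j" if "i \<in> I" "j \<in> I" for i j
    proof -
      have "i * y \<in> I"
        using y that by blast
      then have "x * j + i * y - i * j \<in> I"
        by (rule I(5)[OF I(2)[OF I(3)[OF that(2)]] I(3)[OF that(2)]])
      then have "infdist (x * y) I \<le> dist (x * y) (x * j + i * y - i * j)"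
        by (rule infdist_le)
      also have "\<dots> = norm ((x - i) * (y - j))"
        by (simp add: dist_norm algebra_simps)
      also have "\<dots> \<le> dist x i * dist y j"
        unfolding dist_norm by (rule norm_mult_ineq)
      finally show ?thesis .
    qed
    have **: "infdist (x * y) I \<le> infdist x I * dist y j" if j: "j \<in> I" for j
    proof (cases "dist y j = 0")
      case True
      then show ?thesis
        using *[OF j j] by simp
    next
      case False
      then have pos: "dist y j > 0"
        by simp
      have "infdist (x * y) I / dist y j \<le> infdist x I"
        using ne * j pos by (intro infdist_greatest) (auto simp: divide_le_eq)
      then show ?thesis
        using pos by (simp add: divide_le_eq)
    qed
    show ?thesis
    proof (cases "infdist x I = 0")
      case True
      then show ?thesis
        using **[OF I(1)] by simp
    next
      case False
      then have pos: "infdist x I > 0"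
        using infdist_nonneg[of x I] by simp
      have "infdist (x * y) I / infdist x I \<le> infdist y I"
        using ne ** pos by (intro infdist_greatest) (auto simp: divide_le_eq mult.commute)
      then show ?thesis
        using pos by (simp add: divide_le_eq mult.commute)
    qed
  qed
qed

text \<open>Gelfand--Mazur for the endomorphism ring of the simple module \<open>A/I\<close>, which is the quotient by
  \<open>I\<close> of the idealizer of \<open>I\<close> (with the opposite multiplication).\<close>

lemma maximal_left_ideal_idealizer_scalar:
  fixes I :: "'a::complex_banach_algebra_1 set"
  assumes max: "maximal_left_ideal I" and b: "\<And>i. i \<in> I \<Longrightarrow> i * b \<in> I"
  shows "\<exists>l. b - l *\<^sub>C 1 \<in> I"
proof (rule ccontr)
  assume no: "\<nexists>l. b - l *\<^sub>C 1 \<in> I"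
  have left: "left_ideal I" and "1 \<notin> I"
    using max by (simp_all add: maximal_left_ideal_def)
  note I = left_idealD[OF left] left_ideal_scaleC[OF left]
  define D where "D = {b. \<forall>i\<in>I. i * b \<in> I}"
  define p where "p x = infdist x I" for x
  interpret algebra_seminorm D p
    unfolding D_def p_def by (rule algebra_seminorm_idealizer[OF left])
  have p_null: "p x = 0" if "x \<in> I" for x
    using that by (simp add: p_def)
  \<comment> \<open>Right multiplication by \<open>x\<close> is a nonzero endomorphism of the simple
    quotient. Its injectivity is \<open>null\<close>, its surjectivity gives \<open>c\<close>;
    injectivity then shows that \<open>c\<close> idealizes \<open>I\<close> and is also a right
    inverse.\<close>
  have schur: "\<exists>c\<in>D. c * x - 1 \<in> I \<and> x * c - 1 \<in> I" if x: "x \<in> D" "x \<notin> I" for x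
  proof -
    have null: "a \<in> I" if "a * x \<in> I" for a
    proof (rule ccontr)
      assume "a \<notin> I"
      then obtain d where "d * a - 1 \<in> I"
        using maximal_left_ideal_cases[OF max] by blast
      then have "(d * a - 1) * x \<in> I"
        using x by (simp add: D_def)
      moreover have "d * (a * x) \<in> I"
        by (intro I that)
      ultimately have "d * (a * x) - (d * a - 1) * x \<in> I"
        by (rule I(5)[rotated])
      then show False
        using x by (simp add: algebra_simps)
    qed
    obtain c where c: "c * x - 1 \<in> I"
      using maximal_left_ideal_cases[OF max x(2)] by blast
    have "i * c \<in> I" if "i \<in> I" for i
    proof (rule null)
      have "i * (c * x - 1) + i \<in> I"
        by (intro I c that)
      then show "i * c * x \<in> I"
        by (simp add: algebra_simps)
    qed
    moreover have "x * c - 1 \<in> I"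
    proof (rule null)
      have "x * (c * x - 1) \<in> I"
        by (intro I c)
      then show "(x * c - 1) * x \<in> I"
        by (simp add: algebra_simps)
    qed
    ultimately show ?thesis
      using c by (auto simp: D_def)
  qed
  have bD: "b \<in> D"
    using b by (simp add: D_def)
  have "\<exists>c\<in>D. p (c * (1 - l *\<^sub>C b) - 1) = 0 \<and> p ((1 - l *\<^sub>C b) * c - 1) = 0" for l
  proof -
    have "1 - l *\<^sub>C b \<notin> I"
    proof
      assume *: "1 - l *\<^sub>C b \<in> I"
      then have "l \<noteq> 0"
        using \<open>1 \<notin> I\<close> by auto
      moreover have "- (1 / l) *\<^sub>C (1 - l *\<^sub>C b) \<in> I"
        by (intro I *)
      ultimately have "b - (1 / l) *\<^sub>C 1 \<in> I"
        by (simp add: scaleC_diff_right scaleC_scaleC)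
      then show False
        using no by blast
    qed
    then obtain c where "c \<in> D" "c * (1 - l *\<^sub>C b) - 1 \<in> I" "(1 - l *\<^sub>C b) * c - 1 \<in> I"
      using schur[of "1 - l *\<^sub>C b"] bD by (auto simp: mem)
    then show ?thesis
      using p_null by blast
  qed
  note lim = power_tendsto_zero_if_resolvent[OF bD this]
  have "b \<notin> I"
    using no[simplified, rule_format, of 0] by simp
  \<comment> \<open>A left inverse forces \<open>p 1 \<le> p c ^ n * p (b ^ n)\<close>, and the
    choice \<open>\<rho> = p c\<close> in \<open>lim\<close> sends the right side to 0. As
    \<open>I\<close> is closed, \<open>1\<close> would lie in \<open>I\<close>.\<close>
  then obtain c where c: "c \<in> D" "c * b - 1 \<in> I"
    using schur bD by blast
  have cb: "c ^ n * b ^ n - 1 \<in> I" for n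
  proof (induction n)
    case (Suc n)
    have "c * ((c ^ n * b ^ n - 1) * b) + (c * b - 1) \<in> I"
      by (intro I b Suc.IH c)
    then show ?case
      by (simp add: algebra_simps power_commutes)
  qed (simp add: I)
  have p1: "p 1 \<le> 1"
    using infdist_le[OF I(1), of 1] by (simp add: p_def)
  have pow: "p (c ^ n) \<le> p c ^ n" for n
  proof (induction n)
    case (Suc n)
    have "p (c ^ Suc n) \<le> p c * p (c ^ n)"
      unfolding power_Suc by (intro p_mult c mem)
    also have "\<dots> \<le> p c * p c ^ n"
      by (intro mult_left_mono Suc.IH p_nonneg c)
    finally show ?case
      by simp
  qed (simp add: p1)
  have "p 1 \<le> p c ^ n * p (b ^ n)" for n
  proof -
    have "1 - c ^ n * b ^ n \<in> I"
      using I(4)[OF cb[of n]] by simp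
    then have "p 1 \<le> p (c ^ n * b ^ n)"
      by (intro p_le_if_null_diff p_null mem c bD)
    also have "\<dots> \<le> p (c ^ n) * p (b ^ n)"
      by (intro p_mult mem c bD)
    also have "\<dots> \<le> p c ^ n * p (b ^ n)"
      by (intro mult_right_mono pow p_nonneg mem bD)
    finally show ?thesis .
  qed
  then have "p 1 \<le> 0"
    using lim[OF p_nonneg[OF c(1)]] by (intro LIMSEQ_le_const) auto
  then have "infdist 1 I = 0"
    using infdist_nonneg[of 1 I] by (simp add: p_def)
  then show False
    using in_closed_iff_infdist_zero[OF maximal_left_ideal_closed[OF max]] I(1) \<open>1 \<notin> I\<close> by blast
qed

section \<open>Selfadjoint elements\<close>

lemma star_zero [simp]: "star 0 = (0 :: 'a::cstar_algebra)"
  using star_scaleC[of 0 "0::'a"] by simp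

lemma star_minus: "star (- a) = - star (a :: 'a::cstar_algebra)"
  using star_scaleC[of "- 1" a] by simp

lemma norm_star [simp]: "norm (star a) = norm (a :: 'a::cstar_algebra)"
proof -
  have le: "norm b \<le> norm (star b)" for b :: 'a
  proof (cases "b = 0")
    case False
    have "norm b * norm b \<le> norm (star b) * norm b"
      using norm_mult_ineq[of "star b" b] by (simp add: cstar_identity power2_eq_square)
    then show ?thesis
      using False by simp
  qed simp
  show ?thesis
    using le[of a] le[of "star a"] by (simp add: star_star)
qed

lemma cstar_identity': "norm (a * star a) = (norm (a :: 'a::cstar_algebra))\<^sup>2"
  using cstar_identity[of "star a"] by (simp add: star_star)

lemma eq_zero_if_annihilates:
  fixes a :: "'a::cstar_algebra"
  assumes "\<And>b. a * b = 0"
  shows "a = 0"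
  using assms[of "star a"] cstar_identity'[of a] by simp

section \<open>The embedding of the algebra and the involution of the unitization\<close>

definition embed :: "'a::cstar_algebra \<Rightarrow> 'a unitization" where
  "embed a = Unitization 0 a"

lemma embed_zero [simp]: "embed 0 = 0"
  and embed_add: "embed (a + b) = embed a + embed b"
  and embed_diff: "embed (a - b) = embed a - embed b"
  and embed_mult: "embed (a * b) = embed a * embed b"
  and embed_scaleC: "embed (c *\<^sub>C a) = c *\<^sub>C embed a"
  and norm_embed [simp]: "norm (embed a) = norm a"
  by (simp_all add: embed_def unitization_arith_defs norm_unitization_def)

lemma embed_eq_iff [simp]: "embed a = embed b \<longleftrightarrow> a = b"
  by (simp add: embed_def)

lemma unitization_decompose: "x = scalar_part x *\<^sub>C 1 + embed (algebra_part x)"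
  by (cases x) (simp add: embed_def unitization_arith_defs)

lemma mult_embed: "x * embed a = embed (scalar_part x *\<^sub>C a + algebra_part x * a)"
  by (simp add: embed_def unitization_arith_defs)

text \<open>The C*-identity gives the exponents \<open>2 ^ m\<close>; a loss at some
  \<open>n < 2 ^ m\<close> would spread to \<open>2 ^ m\<close> by submultiplicativity. Powers are
  formed in the unitization because \<open>A\<close> may have no unit.\<close>

lemma norm_embed_power_selfadjoint:
  fixes h :: "'a::cstar_algebra"
  assumes "star h = h"
  shows "norm (embed h ^ n) = norm h ^ n"
proof (cases "h = 0")
  case False
  have two: "\<exists>k. star k = k \<and> embed h ^ (2 ^ m) = embed k \<and> norm k = norm h ^ (2 ^ m)" for m
  proof (induction m)
    case (Suc m)
    then obtain k where k: "star k = k" "embed h ^ (2 ^ m) = embed k" "norm k = norm h ^ (2 ^ m)"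
      by blast
    have "star (k * k) = k * k"
      by (simp add: star_mult k)
    moreover have "embed h ^ (2 ^ Suc m) = embed (k * k)"
      by (simp add: power_mult k embed_mult power2_eq_square mult.commute[of 2])
    moreover have "norm (k * k) = norm h ^ (2 ^ Suc m)"
      using cstar_identity[of k] by (simp add: k power_mult mult.commute[of 2])
    ultimately show ?case
      by blast
  qed (use assms in auto)
  obtain m :: nat where m: "n < 2 ^ m"
    using less_exp by blast
  obtain k where "embed h ^ (2 ^ m) = embed k" "norm k = norm h ^ (2 ^ m)"
    using two by blast
  then have "norm h ^ n * norm h ^ (2 ^ m - n) = norm (embed h ^ n * embed h ^ (2 ^ m - n))"
    using m by (simp flip: power_add)
  also have "\<dots> \<le> norm (embed h ^ n) * norm (embed h ^ (2 ^ m - n))"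
    by (rule norm_mult_ineq)
  also have "\<dots> \<le> norm (embed h ^ n) * norm h ^ (2 ^ m - n)"
    using norm_power_ineq[of "embed h"] by (intro mult_left_mono) auto
  finally have "norm h ^ n \<le> norm (embed h ^ n)"
    using False by simp
  then show ?thesis
    using norm_power_ineq[of "embed h" n] by simp
qed (cases n; simp)

text \<open>A plain function rather than a class instance: the sum norm violates the C*-identity in
  general.\<close>

definition unitization_star :: "'a::cstar_algebra unitization \<Rightarrow> 'a unitization" where
  "unitization_star x = Unitization (cnj (scalar_part x)) (star (algebra_part x))"

lemma unitization_star_one [simp]: "unitization_star 1 = 1"
  and unitization_star_mult: "unitization_star (x * y) = unitization_star y * unitization_star x"
  and unitization_star_add: "unitization_star (x + y) = unitization_star x + unitization_star y"
  and unitization_star_diff: "unitization_star (x - y) = unitization_star x - unitization_star y"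
  and unitization_star_scaleC: "unitization_star (c *\<^sub>C x) = cnj c *\<^sub>C unitization_star x"
  and unitization_star_embed: "unitization_star (embed a) = embed (star a)"
  using star_add[of "algebra_part x" "- algebra_part y"]
  by (simp_all add: unitization_star_def unitization_arith_defs embed_def star_add star_scaleC
      star_mult star_minus)

lemma algebra_seminorm_norm: "algebra_seminorm UNIV (norm :: 'b::complex_banach_algebra_1 \<Rightarrow> real)"
  by standard (auto simp: norm_triangle_ineq norm_scaleC norm_mult_ineq)

text \<open>If \<open>1 - l *\<^sub>C embed h\<close> had no left inverse, it would lie in a maximal
  left ideal together with \<open>embed h\<close>, hence so would \<open>1\<close>. The involution,
  applied at \<open>cnj l\<close>, turns left inverses into right inverses. So the resolvent of
  \<open>h = star a * a\<close> exists everywhere, and its powers decay too fast for a nonzero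
  selfadjoint element.\<close>

lemma eq_zero_if_in_maximal_left_ideals:
  fixes a :: "'a::cstar_algebra"
  assumes "\<And>I. maximal_left_ideal I \<Longrightarrow> embed a \<in> I"
  shows "a = 0"
proof -
  define h where "h = star a * a"
  have h: "star h = h"
    by (simp add: h_def star_mult star_star)
  have hI: "embed h \<in> I" if "maximal_left_ideal I" for I
    using assms[OF that] that
    by (auto simp: h_def embed_mult maximal_left_ideal_def intro: left_idealD)
  have left: "\<exists>c. c * (1 - l *\<^sub>C embed h) = 1" for l
  proof (rule ccontr)
    assume "\<nexists>c. c * (1 - l *\<^sub>C embed h) = 1"
    then have "1 \<notin> range (\<lambda>c. c * (1 - l *\<^sub>C embed h))"
      by (metis imageE)
    then obtain I where I: "maximal_left_ideal I" "range (\<lambda>c. c * (1 - l *\<^sub>C embed h)) \<subseteq> I"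
      using maximal_left_ideal_exists[OF left_ideal_principal] by blast
    have li: "left_ideal I"
      using I(1) by (simp add: maximal_left_ideal_def)
    have "1 * (1 - l *\<^sub>C embed h) \<in> I"
      using I(2) by blast
    then have "1 * (1 - l *\<^sub>C embed h) + l *\<^sub>C embed h \<in> I"
      by (intro left_idealD(2)[OF li] left_ideal_scaleC[OF li] hI I)
    then show False
      using I(1) by (simp add: maximal_left_ideal_def)
  qed
  have inv: "\<exists>c\<in>UNIV. norm (c * (1 - l *\<^sub>C embed h) - 1) = 0 \<and> norm ((1 - l *\<^sub>C embed h) * c - 1) = 0"
    for l
  proof -
    obtain c where c: "c * (1 - l *\<^sub>C embed h) = 1"
      using left by blast
    obtain d where "d * (1 - cnj l *\<^sub>C embed h) = 1"
      using left by blast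
    from arg_cong[OF this, of unitization_star]
    have d: "(1 - l *\<^sub>C embed h) * unitization_star d = 1"
      by (simp add: unitization_star_mult unitization_star_diff unitization_star_scaleC
          unitization_star_embed h)
    have "c = c * ((1 - l *\<^sub>C embed h) * unitization_star d)"
      by (simp only: d mult_1_right)
    also have "\<dots> = unitization_star d"
      by (simp only: mult.assoc[symmetric] c mult_1_left)
    finally show ?thesis
      using c d by (intro bexI[of _ c]) auto
  qed
  have lim: "(\<lambda>n. (1 / norm h) ^ n * norm (embed h ^ n)) \<longlonglongrightarrow> 0"
    by (rule algebra_seminorm.power_tendsto_zero_if_resolvent[OF algebra_seminorm_norm UNIV_I inv])
      simp
  have "h = 0"
  proof (rule ccontr)
    assume "h \<noteq> 0"
    then have "(\<lambda>n. (1 / norm h) ^ n * norm (embed h ^ n)) = (\<lambda>_. 1)"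
      by (auto simp: norm_embed_power_selfadjoint h power_divide)
    with lim show False
      by (simp add: LIMSEQ_const_iff)
  qed
  then show ?thesis
    using cstar_identity[of a] by (simp add: h_def)
qed

text \<open>The Cayley transform \<open>1 + 2 *\<^sub>C embed v\<close> is unitary: from
  \<open>w + w' = 1 + 1\<close> one gets \<open>s + r = r * s + r * s\<close>, which reads
  \<open>2 *\<^sub>C (v * star v) = - (v + star v)\<close> inside \<open>A\<close>, where the
  C*-identity applies.\<close>

lemma norm_resolvent_selfadjoint_le:
  fixes b v :: "'a::cstar_algebra" and t :: real
  assumes b: "star b = b"
    and left: "(1 + embed v) * (1 + (\<i> * t) *\<^sub>C embed b) = 1"
    and right: "(1 + (\<i> * t) *\<^sub>C embed b) * (1 + embed v) = 1"
  shows "norm v \<le> 1"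
proof -
  define r s where "r = 1 + embed v" and "s = 1 + embed (star v)"
  define w w' where "w = 1 + (\<i> * t) *\<^sub>C embed b" and "w' = 1 - (\<i> * t) *\<^sub>C embed b"
  have two: "2 *\<^sub>C x = x + x" for x :: "'a unitization"
    using scaleC_add_left[of 1 1 x] by simp
  have star: "unitization_star r = s" "unitization_star w = w'"
    by (simp_all add: r_def s_def w_def w'_def unitization_star_add unitization_star_scaleC
        unitization_star_embed b)
  have rw: "r * w = 1"
    using left by (simp only: r_def w_def)
  have ws: "w' * s = 1"
    using arg_cong[OF rw, of unitization_star] by (simp add: unitization_star_mult star)
  have "s + r = (r * w) * s + r * (w' * s)"
    by (simp only: rw ws mult_1_left mult_1_right)
  also have "\<dots> = r * (w + w') * s"
    by (simp only: distrib_left distrib_right mult.assoc)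
  also have "w + w' = 1 + 1"
    by (simp add: w_def w'_def)
  finally have "s + r = r * s + r * s"
    by (simp only: distrib_left distrib_right mult_1_right)
  then have "embed (v + star v + 2 *\<^sub>C (v * star v)) = 0"
    by (simp add: r_def s_def embed_add embed_mult embed_scaleC two distrib_left distrib_right
        algebra_simps)
  then have "v + star v + 2 *\<^sub>C (v * star v) = 0"
    by (metis embed_eq_iff embed_zero)
  then have eq: "2 *\<^sub>C (v * star v) = - (v + star v)"
    by (rule add_eq_0_iff[THEN iffD1])
  have "2 * (norm v)\<^sup>2 = norm (2 *\<^sub>C (v * star v))"
    by (simp add: norm_scaleC cstar_identity')
  also have "\<dots> \<le> 2 * norm v"
    unfolding eq norm_minus_cancel using norm_triangle_ineq[of v "star v"] by simp
  finally show ?thesis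
    by (cases "norm v = 0") (simp_all add: power2_eq_square)
qed

text \<open>Since the resolvents in question have norm at most \<open>2\<close>, the point \<open>t\<close> can be moved along the
  imaginary axis in steps of constant length.\<close>

lemma resolvent_selfadjoint:
  fixes b :: "'a::cstar_algebra" and t :: real
  assumes b: "star b = b" and "t \<ge> 0"
  shows "\<exists>v. (1 + embed v) * (1 + (\<i> * t) *\<^sub>C embed b) = 1 \<and>
             (1 + (\<i> * t) *\<^sub>C embed b) * (1 + embed v) = 1"
proof -
  define w where "w t = 1 + (\<i> * complex_of_real t) *\<^sub>C embed b" for t :: real
  define P where "P t \<longleftrightarrow> (\<exists>v. (1 + embed v) * w t = 1 \<and> w t * (1 + embed v) = 1)" for t
  \<comment> \<open>The scalar part is multiplicative and equals 1 on \<open>w t\<close>.\<close>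
  have unital: "\<exists>v. r = 1 + embed v" if "r * w t = 1" for r t
  proof -
    have "scalar_part r = 1"
      using arg_cong[OF that, of scalar_part] by (simp add: w_def embed_def unitization_arith_defs)
    then show ?thesis
      using unitization_decompose[of r] by auto
  qed
  have step: "P (t + s)" if "P t" and s: "0 \<le> s" "s * norm b \<le> 1 / 4" for t s
  proof -
    obtain v where v: "(1 + embed v) * w t = 1" "w t * (1 + embed v) = 1"
      using \<open>P t\<close> unfolding P_def by blast
    define r where "r = 1 + embed v"
    have r: "r * w t = 1" "w t * r = 1"
      using v by (simp_all only: r_def)
    have "norm v \<le> 1"
      using norm_resolvent_selfadjoint_le[OF b] v unfolding w_def by blast
    then have "norm r \<le> 2"
      using norm_triangle_ineq[of 1 "embed v"] by (simp add: r_def)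
    \<comment> \<open>Here \<open>w (t + s) = w t * (1 - e)\<close>, and the bounds \<open>2\<close>
      on \<open>norm r\<close> and \<open>1 / 4\<close> on \<open>s * norm b\<close> give
      \<open>norm e \<le> 1 / 2\<close>.\<close>
    define e where "e = - (r * ((\<i> * complex_of_real s) *\<^sub>C embed b))"
    have "norm e \<le> norm r * (s * norm b)"
      using s norm_mult_ineq[of r "(\<i> * complex_of_real s) *\<^sub>C embed b"]
      by (simp add: e_def norm_scaleC norm_mult)
    also have "\<dots> \<le> 2 * (1 / 4)"
      using \<open>norm r \<le> 2\<close> s by (intro mult_mono) auto
    finally obtain f where f: "f * (1 - e) = 1" "(1 - e) * f = 1"
      using neumann_inverse[of e] by auto
    have "w t * (1 - e) = w t + (w t * r) * ((\<i> * complex_of_real s) *\<^sub>C embed b)"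
      by (simp add: e_def distrib_left mult.assoc)
    also have "\<dots> = w (t + s)"
      unfolding r by (simp add: w_def distrib_left scaleC_add_left)
    finally have wts: "w (t + s) = w t * (1 - e)" ..
    have 1: "f * r * w (t + s) = 1"
    proof -
      have "f * r * w (t + s) = f * (r * w t) * (1 - e)"
        by (simp only: wts mult.assoc)
      then show ?thesis
        by (simp only: r f mult_1_right)
    qed
    have 2: "w (t + s) * (f * r) = 1"
    proof -
      have "w (t + s) * (f * r) = w t * ((1 - e) * f) * r"
        by (simp only: wts mult.assoc)
      then show ?thesis
        by (simp only: r f mult_1_right)
    qed
    show ?thesis
      using unital[OF 1] 1 2 unfolding P_def by metis
  qed
  have P0: "P 0"
    unfolding P_def by (intro exI[of _ 0]) (simp add: w_def)
  \<comment> \<open>This makes the step \<open>t / m\<close> short enough: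
    \<open>t / m * norm b < 1 / 4\<close>.\<close>
  obtain m :: nat where m: "4 * t * norm b < m"
    using reals_Archimedean2 by blast
  have m0: "m > 0"
    using m \<open>t \<ge> 0\<close> by (metis gr0I less_numeral_extra(3) mult_nonneg_nonneg norm_ge_zero
        not_less of_nat_0 zero_le_numeral)
  have "P (real k * (t / m))" for k
  proof (induction k)
    case (Suc k)
    have "P (real k * (t / m) + t / m)"
      by (rule step[OF Suc.IH]) (use m m0 \<open>t \<ge> 0\<close> in \<open>auto simp: field_simps\<close>)
    moreover have "real (Suc k) * (t / m) = real k * (t / m) + t / m"
      by (simp add: distrib_right add_divide_distrib)
    ultimately show ?case
      by (simp only:)
  qed (simp add: P0)
  from this[of m] show ?thesis
    using m0 by (simp add: P_def w_def)
qed

section \<open>Hilbert modules\<close>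

context hilbert_module
begin

lemma act_zero_left [simp]: "act 0 x = 0"
  using act_add_left[of 0 0 x] by simp

lemma act_zero_right [simp]: "act a 0 = 0"
  using act_add_right[of a 0 0] by simp

lemma act_minus_left: "act (- a) x = - act a x"
  using act_scaleC_left[of "- 1" a x] by simp

lemma act_diff_left: "act (a - b) x = act a x - act b x"
  using act_add_left[of a "- b" x] by (simp add: act_minus_left)

lemma ip_zero_left [simp]: "ip 0 x = 0"
  using ip_add_left[of 0 0 x] by simp

lemma ip_minus_left: "ip (- x) y = - ip x y"
  using ip_scaleC_left[of "- 1" x y] by simp

lemma ip_diff_left: "ip (x - y) z = ip x z - ip y z"
  using ip_add_left[of x "- y" z] by (simp add: ip_minus_left)

lemma eqI_ip:
  assumes "\<And>w. ip x w = ip y w"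
  shows "x = y"
proof -
  have "ip (x - y) (x - y) = 0"
    by (simp add: ip_diff_left assms)
  then show ?thesis
    by (simp add: ip_eq_0_iff)
qed

lemma norm_ip_self: "norm (ip x x) = (norm x)\<^sup>2"
  by (simp add: norm_eq_sqrt_ip)

lemma norm_act_le: "norm (act a x) \<le> norm a * norm x"
proof (rule power2_le_imp_le)
  have "(norm (act a x))\<^sup>2 = norm (a * ip x x * star a)"
    by (simp add: ip_act_left ip_act_right mult.assoc flip: norm_ip_self)
  also have "\<dots> \<le> norm a * norm (ip x x) * norm (star a)"
    by (rule order_trans[OF norm_mult_ineq mult_right_mono[OF norm_mult_ineq]]) simp
  also have "\<dots> = (norm a * norm x)\<^sup>2"
    by (simp add: norm_ip_self power2_eq_square)
  finally show "(norm (act a x))\<^sup>2 \<le> (norm a * norm x)\<^sup>2" .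
qed simp

text \<open>Polarization avoids the order on \<open>A\<close>, on which the Cauchy--Schwarz inequality depends; the
  constant \<open>4\<close> is harmless.\<close>

lemma norm_ip_le: "norm (ip x y) \<le> 4 * norm x * norm y"
proof -
  have sq: "norm (ip x y) \<le> (norm x + norm y)\<^sup>2" for x y
  proof -
    let ?q = "\<lambda>c. ip (x + c *\<^sub>C y) (x + c *\<^sub>C y)"
    have q: "norm (c *\<^sub>C ?q c) \<le> (norm x + norm y)\<^sup>2" if "cmod c = 1" for c
    proof -
      have "norm (x + c *\<^sub>C y) \<le> norm x + norm y"
        using norm_triangle_ineq[of x "c *\<^sub>C y"] that by (simp add: norm_scaleC)
      then show ?thesis
        using that by (simp add: norm_scaleC norm_ip_self)
    qed
    have scale4: "4 *\<^sub>C u = u + u + u + u" for u :: 'a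
      using scaleC_add_left[of 2 2 u] scaleC_add_left[of 1 1 u] by simp
    have qe: "?q c = ip x x + cnj c *\<^sub>C ip x y + c *\<^sub>C ip y x + (c * cnj c) *\<^sub>C ip y y" for c
      by (simp add: ip_add_left ip_add_right ip_scaleC_left ip_scaleC_right scaleC_scaleC
          scaleC_add_right add_ac)
    have "1 *\<^sub>C ?q 1 + \<i> *\<^sub>C ?q \<i> + (- 1) *\<^sub>C ?q (- 1) + (- \<i>) *\<^sub>C ?q (- \<i>) = 4 *\<^sub>C ip x y"
      unfolding qe by (simp add: scale4 scaleC_add_right scaleC_diff_right scaleC_scaleC)
    then have "4 * norm (ip x y)
        = norm (1 *\<^sub>C ?q 1 + \<i> *\<^sub>C ?q \<i> + (- 1) *\<^sub>C ?q (- 1) + (- \<i>) *\<^sub>C ?q (- \<i>))"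
      by (simp add: norm_scaleC)
    also have "\<dots> \<le> (norm x + norm y)\<^sup>2 + (norm x + norm y)\<^sup>2 + (norm x + norm y)\<^sup>2
        + (norm x + norm y)\<^sup>2"
      by (intro norm_triangle_mono q) simp_all
    finally show ?thesis
      by simp
  qed
  show ?thesis
  proof (cases "x = 0 \<or> y = 0")
    case True
    then show ?thesis
      using ip_scaleC_right[of x 0 y] by auto
  next
    case False
    \<comment> \<open>On unit vectors the bound \<open>(norm x + norm y)\<^sup>2\<close> is 4, the
      constant of the claim.\<close>
    let ?x = "complex_of_real (1 / norm x) *\<^sub>C x" and ?y = "complex_of_real (1 / norm y) *\<^sub>C y"
    have "norm ?x = 1" "norm ?y = 1"
      using False by (simp_all add: norm_scaleC norm_divide)
    then have "norm (ip ?x ?y) \<le> 4"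
      using sq[of ?x ?y] by simp
    moreover have "norm (ip ?x ?y) = norm (ip x y) / (norm x * norm y)"
      using False by (simp add: ip_scaleC_left ip_scaleC_right norm_scaleC norm_divide norm_mult)
    ultimately have "norm (ip x y) / (norm x * norm y) \<le> 4"
      by (simp only:)
    moreover have "norm x * norm y > 0"
      using False by simp
    ultimately show ?thesis
      by (simp add: pos_divide_le_eq mult_ac)
  qed
qed

lemma bounded_linear_act_left: "bounded_linear (\<lambda>a. act a x)"
proof (rule bounded_linear_intro)
  show "act (r *\<^sub>R a) x = r *\<^sub>R act a x" for r a
    by (simp add: act_scaleC_left flip: scaleC_of_real)
qed (rule act_add_left norm_act_le)+

section \<open>The action of the unitization on the module\<close>

definition uact :: "'a unitization \<Rightarrow> 'x \<Rightarrow> 'x" where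
  "uact r x = scalar_part r *\<^sub>C x + act (algebra_part r) x"

lemma uact_one [simp]: "uact 1 x = x"
  by (simp add: uact_def one_unitization_def)

lemma uact_embed: "uact (embed a) x = act a x"
  by (simp add: uact_def embed_def)

lemma uact_mult: "uact (r * s) x = uact r (uact s x)"
  by (simp add: uact_def times_unitization_def scaleC_add_right act_add_left act_add_right
      act_scaleC_left act_scaleC_right act_mult scaleC_scaleC add_ac)

lemma norm_uact_le: "norm (uact r x) \<le> norm r * norm x"
proof -
  have "norm (uact r x) \<le> cmod (scalar_part r) * norm x + norm (algebra_part r) * norm x"
    unfolding uact_def by (intro norm_triangle_mono norm_act_le) (simp add: norm_scaleC)
  then show ?thesis
    by (simp add: norm_unitization_def distrib_right)
qed

lemma embed_ip_uact_left: "embed (ip (uact r x) y) = r * embed (ip x y)"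
  by (simp add: uact_def mult_embed ip_add_left ip_scaleC_left ip_act_left)

lemma embed_ip_uact_right: "embed (ip x (uact r y)) = embed (ip x y) * unitization_star r"
proof -
  have "embed (ip x (uact r y)) = unitization_star (embed (ip (uact r y) x))"
    by (simp add: unitization_star_embed flip: ip_star)
  then show ?thesis
    by (simp add: embed_ip_uact_left unitization_star_mult unitization_star_embed flip: ip_star)
qed

text \<open>The vector \<open>y = (1 + i t \<langle>x, x\<rangle>)\<^sup>-\<^sup>1 x\<close> differs from \<open>x\<close> by an element of \<open>A x\<close> and is small
  for large \<open>t\<close>.\<close>

lemma act_approximates:
  assumes "e > 0"
  shows "\<exists>u. norm (x - act u x) < e"
proof -
  define b where "b = ip x x"
  have b: "star b = b"
    by (simp add: b_def flip: ip_star)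
  \<comment> \<open>The estimate below is \<open>(norm ?y)\<^sup>2 \<le> 2 / t\<close>, and
    \<open>2 / t\<close> is two thirds of \<open>e\<^sup>2\<close>.\<close>
  define t where "t = 3 / e\<^sup>2"
  have t: "t > 0"
    using assms by (simp add: t_def)
  obtain v where left: "(1 + embed v) * (1 + (\<i> * t) *\<^sub>C embed b) = 1"
    and right: "(1 + (\<i> * t) *\<^sub>C embed b) * (1 + embed v) = 1"
    using resolvent_selfadjoint[OF b] t by (meson less_imp_le)
  have v: "norm v \<le> 1"
    by (rule norm_resolvent_selfadjoint_le[OF b left right])
  define r where "r = 1 + embed v"
  \<comment> \<open>Solving \<open>r * (1 + (\<i> * t) *\<^sub>C embed b) = 1\<close> for the
    product with \<open>b\<close> gains the factor \<open>1 / t\<close>. It controls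
    \<open>?y\<close> because the inner product of \<open>?y\<close> with itself is
    \<open>r * embed b * unitization_star r\<close>.\<close>
  have "r + (\<i> * t) *\<^sub>C (r * embed b) = 1"
    using left by (simp only: r_def[symmetric] distrib_left mult_1_right scaleC_mult_right)
  then have rb: "(\<i> * t) *\<^sub>C (r * embed b) = - embed v"
    by (simp add: r_def add.assoc add_eq_0_iff)
  then have "norm ((\<i> * t) *\<^sub>C (r * embed b)) = norm v"
    by (simp only: norm_minus_cancel norm_embed)
  then have "t * norm (r * embed b) = norm v"
    using t by (simp add: norm_scaleC norm_mult)
  then have rb: "norm (r * embed b) \<le> 1 / t"
    using v t by (simp add: field_simps)
  have "unitization_star r = 1 + embed (star v)"
    by (simp add: r_def unitization_star_add unitization_star_embed)
  then have rs: "norm (unitization_star r) \<le> 2"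
    using norm_triangle_ineq[of 1 "embed (star v)"] v by simp
  let ?y = "uact r x"
  have "(norm ?y)\<^sup>2 = norm (embed (ip ?y ?y))"
    by (simp add: norm_ip_self)
  also have "\<dots> = norm (r * embed b * unitization_star r)"
    by (simp only: embed_ip_uact_left embed_ip_uact_right b_def mult.assoc)
  also have "\<dots> \<le> norm (r * embed b) * norm (unitization_star r)"
    by (rule norm_mult_ineq)
  also have "\<dots> \<le> (1 / t) * 2"
    using rb rs t by (intro mult_mono) auto
  also have "\<dots> < e\<^sup>2"
    using assms by (simp add: t_def)
  finally have "norm ?y < e"
    using assms by (simp add: power_less_imp_less_base)
  moreover have "?y = x - act (- v) x"
    by (simp add: r_def uact_def act_minus_left embed_def unitization_arith_defs)
  ultimately show ?thesis
    by metis
qed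

end

section \<open>Morphisms preserving the closed submodules\<close>

locale local_morphism = hilbert_module act ip
  for act :: "'a::cstar_algebra \<Rightarrow> 'x::{complex_normed_vector, banach} \<Rightarrow> 'x"
    and ip :: "'x \<Rightarrow> 'x \<Rightarrow> 'a" +
  fixes T :: "'x \<Rightarrow> 'x"
  assumes morphism: "bounded_module_morphism act T"
    and invariant: "is_submodule act Y \<Longrightarrow> closed Y \<Longrightarrow> T ` Y \<subseteq> Y"
begin

lemma T_simps:
  "T (x + y) = T x + T y" "T (x - y) = T x - T y" "T (c *\<^sub>C x) = c *\<^sub>C T x"
  "T (act a x) = act a (T x)" "T (uact r x) = uact r (T x)"
proof -
  interpret T: bounded_linear T
    using morphism by (simp add: bounded_module_morphism_def bounded_clinear_def)
  show add: "T (x + y) = T x + T y" for x y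
    by (rule T.add)
  show "T (x - y) = T x - T y"
    by (rule T.diff)
  show scale: "T (c *\<^sub>C x) = c *\<^sub>C T x" for c x
    using morphism by (simp add: bounded_module_morphism_def bounded_clinear_def)
  show act: "T (act a x) = act a (T x)" for a x
    using morphism by (simp add: bounded_module_morphism_def)
  show "T (uact r x) = uact r (T x)"
    by (simp add: uact_def add scale act)
qed

context
  fixes I :: "'a unitization set"
  assumes max: "maximal_left_ideal I"
begin

lemma left_ideal_I: "left_ideal I"
  using max by (simp add: maximal_left_ideal_def)

lemmas I_mem = left_idealD[OF left_ideal_I] left_ideal_scaleC[OF left_ideal_I]

lemma kernel_invariant:
  assumes "embed (ip z g) \<in> I"
  shows "embed (ip (T z) g) \<in> I"
proof -
  let ?N = "{z. embed (ip z g) \<in> I}"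
  have "is_submodule act ?N"
    unfolding is_submodule_def complex_vector.subspace_def
    by (auto simp: I_mem(1) ip_add_left embed_add ip_scaleC_left embed_scaleC ip_act_left embed_mult
        intro: I_mem)
  moreover have "closed ?N"
  proof -
    have "bounded_linear (\<lambda>z. embed (ip z g))"
    proof (rule bounded_linear_intro)
      show "embed (ip (r *\<^sub>R z) g) = r *\<^sub>R embed (ip z g)" for r z
        by (simp add: ip_scaleC_left embed_scaleC flip: scaleC_of_real)
      show "norm (embed (ip z g)) \<le> norm z * (4 * norm g)" for z
        using norm_ip_le[of z g] by (simp add: mult_ac)
    qed (simp add: ip_add_left embed_add)
    then have "continuous_on UNIV (\<lambda>z. embed (ip z g))"
      by (rule linear_continuous_on)
    from closed_vimage[OF maximal_left_ideal_closed[OF max] this] show ?thesis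
      by (simp add: vimage_def)
  qed
  ultimately show ?thesis
    using invariant[of ?N] assms by blast
qed

text \<open>The map \<open>z \<mapsto> \<langle>z, g\<rangle> + I\<close> is zero or onto the simple module \<open>A/I\<close>; since \<open>T\<close> preserves its
  kernel, it induces an endomorphism of \<open>A/I\<close>, which is a scalar.\<close>

lemma scalar_mod_ideal:
  "\<exists>l. \<forall>z. embed (ip (T z) g) - l *\<^sub>C embed (ip z g) \<in> I"
proof (cases "\<forall>z. embed (ip z g) \<in> I")
  case True
  then show ?thesis
    by (intro exI[of _ 0]) simp
next
  case False
  then obtain z0 where "embed (ip z0 g) \<notin> I"
    by blast
  then obtain a where "a * embed (ip z0 g) - 1 \<in> I"
    using maximal_left_ideal_cases[OF max] by blast
  \<comment> \<open>The vector \<open>z1\<close> represents \<open>1\<close> in the quotient, so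
    \<open>b\<close> is the image of \<open>1\<close> under the induced endomorphism, which is
    therefore right multiplication by \<open>b\<close>.\<close>
  define z1 where "z1 = uact a z0"
  define b where "b = embed (ip (T z1) g)"
  have z1: "embed (ip z1 g) - 1 \<in> I"
    using \<open>a * embed (ip z0 g) - 1 \<in> I\<close> by (simp add: z1_def embed_ip_uact_left)
  have Ib: "i * b \<in> I" if "i \<in> I" for i
  proof -
    have "i * (embed (ip z1 g) - 1) + i \<in> I"
      by (intro I_mem z1 that)
    then have "embed (ip (uact i z1) g) \<in> I"
      by (simp add: embed_ip_uact_left algebra_simps)
    from kernel_invariant[OF this] show ?thesis
      by (simp add: T_simps embed_ip_uact_left b_def)
  qed
  obtain l where l: "b - l *\<^sub>C 1 \<in> I"
    using maximal_left_ideal_idealizer_scalar[OF max Ib] by blast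
  show ?thesis
  proof (intro exI[of _ l] allI)
    fix z
    define a where "a = embed (ip z g)"
    \<comment> \<open>The vector \<open>z - uact a z1\<close> lies in the invariant kernel, so
      modulo \<open>I\<close> the inner product with \<open>T z\<close> is \<open>a * b\<close>,
      hence \<open>l *\<^sub>C a\<close>.\<close>
    have "- (a * (embed (ip z1 g) - 1)) \<in> I"
      by (intro I_mem z1)
    then have "embed (ip (z - uact a z1) g) \<in> I"
      by (simp add: ip_diff_left embed_diff embed_ip_uact_left a_def algebra_simps)
    from kernel_invariant[OF this] have "embed (ip (T z) g) - a * b \<in> I"
      by (simp add: T_simps ip_diff_left embed_diff embed_ip_uact_left b_def)
    moreover have "a * (b - l *\<^sub>C 1) \<in> I"
      by (intro I_mem l)
    ultimately have "(embed (ip (T z) g) - a * b) + a * (b - l *\<^sub>C 1) \<in> I"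
      by (rule I_mem)
    then show "embed (ip (T z) g) - l *\<^sub>C embed (ip z g) \<in> I"
      by (simp add: a_def right_diff_distrib scaleC_mult_right)
  qed
qed

text \<open>Eigenvectors to distinct eigenvalues are independent. Comparing the scalars of
  \<open>g0\<close>, \<open>g\<close> and \<open>g0 + g\<close> gives a relation between the
  functionals \<open>\<alpha>\<close> and \<open>\<beta>\<close>; evaluated at \<open>T z\<close> it
  gives a second one with the coefficients multiplied by the eigenvalues. If these differ, both
  coefficients vanish, and then the eigenvalues coincide after all. A functional that is zero modulo
  \<open>I\<close> accepts any scalar.\<close>

lemma uniform_scalar_mod_ideal:
  "\<exists>l. \<forall>z g. embed (ip (T z) g) - l *\<^sub>C embed (ip z g) \<in> I"
proof -
  obtain l where l: "embed (ip (T z) g) - l g *\<^sub>C embed (ip z g) \<in> I" for z g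
    using scalar_mod_ideal by metis
  show ?thesis
  proof (cases "\<forall>g z. embed (ip z g) \<in> I")
    case True
    then show ?thesis
      by (intro exI[of _ 0]) simp
  next
    case False
    then obtain g0 z0 where z0: "embed (ip z0 g0) \<notin> I"
      by blast
    show ?thesis
    proof (intro exI[of _ "l g0"] allI)
      fix z g
      show "embed (ip (T z) g) - l g0 *\<^sub>C embed (ip z g) \<in> I"
      proof (cases "l g = l g0 \<or> (\<forall>z. embed (ip z g) \<in> I)")
        case True
        then show ?thesis
          using l[of z g] by (auto intro: I_mem)
      next
        case False
        then obtain z1 where ne: "l g \<noteq> l g0" and z1: "embed (ip z1 g) \<notin> I"
          by blast
        define p q where "p = l (g0 + g) - l g0" and "q = l (g0 + g) - l g"
        define \<alpha> \<beta> where "\<alpha> z = embed (ip z g0)" and "\<beta> z = embed (ip z g)" for z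
        have T: "\<alpha> (T z) - l g0 *\<^sub>C \<alpha> z \<in> I" "\<beta> (T z) - l g *\<^sub>C \<beta> z \<in> I" for z
          using l by (simp_all add: \<alpha>_def \<beta>_def)
        have rel: "p *\<^sub>C \<alpha> z + q *\<^sub>C \<beta> z \<in> I" for z
        proof -
          have "\<alpha> (T z) + \<beta> (T z) - l (g0 + g) *\<^sub>C (\<alpha> z + \<beta> z) \<in> I"
            using l[of z "g0 + g"] by (simp add: \<alpha>_def \<beta>_def ip_add_right embed_add)
          then have "(\<alpha> (T z) - l g0 *\<^sub>C \<alpha> z) + (\<beta> (T z) - l g *\<^sub>C \<beta> z)
              - (\<alpha> (T z) + \<beta> (T z) - l (g0 + g) *\<^sub>C (\<alpha> z + \<beta> z)) \<in> I"
            by (rule I_mem(5)[OF I_mem(2)[OF T]])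
          then show ?thesis
            by (simp add: p_def q_def scaleC_add_right complex_vector.scale_left_diff_distrib
                algebra_simps)
        qed
        have relT: "(p * l g0) *\<^sub>C \<alpha> z + (q * l g) *\<^sub>C \<beta> z \<in> I" for z
        proof -
          have "(p *\<^sub>C \<alpha> (T z) + q *\<^sub>C \<beta> (T z)) - p *\<^sub>C (\<alpha> (T z) - l g0 *\<^sub>C \<alpha> z)
              - q *\<^sub>C (\<beta> (T z) - l g *\<^sub>C \<beta> z) \<in> I"
            by (intro I_mem(5) I_mem(6) rel T)
          then show ?thesis
            by (simp add: scaleC_diff_right scaleC_scaleC)
        qed
        have zero: "c = 0" if "c *\<^sub>C x \<in> I" "x \<notin> I" for c x
        proof (rule ccontr)
          assume "c \<noteq> 0"
          then have "x = (1 / c) *\<^sub>C c *\<^sub>C x"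
            by (simp add: scaleC_scaleC)
          then show False
            using I_mem(6)[OF that(1)] that(2) by metis
        qed
        have "((p * l g0) *\<^sub>C \<alpha> z0 + (q * l g) *\<^sub>C \<beta> z0) - l g *\<^sub>C (p *\<^sub>C \<alpha> z0 + q *\<^sub>C \<beta> z0) \<in> I"
          by (intro I_mem(5) I_mem(6) rel relT)
        then have "(p * (l g0 - l g)) *\<^sub>C \<alpha> z0 \<in> I"
          by (simp add: scaleC_add_right scaleC_scaleC algebra_simps
              flip: complex_vector.scale_left_diff_distrib)
        then have "p = 0"
          using zero[of _ "\<alpha> z0"] z0 ne unfolding \<alpha>_def by fastforce
        have "((p * l g0) *\<^sub>C \<alpha> z1 + (q * l g) *\<^sub>C \<beta> z1) - l g0 *\<^sub>C (p *\<^sub>C \<alpha> z1 + q *\<^sub>C \<beta> z1) \<in> I"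
          by (intro I_mem(5) I_mem(6) rel relT)
        then have "(q * (l g - l g0)) *\<^sub>C \<beta> z1 \<in> I"
          by (simp add: scaleC_add_right scaleC_scaleC algebra_simps
              flip: complex_vector.scale_left_diff_distrib)
        then have "q = 0"
          using zero[of _ "\<beta> z1"] z1 ne unfolding \<beta>_def by fastforce
        then show ?thesis
          using \<open>p = 0\<close> ne by (simp add: p_def q_def)
      qed
    qed
  qed
qed

text \<open>Left multiplication handles the first product. In the second one the right factor
  \<open>ip y w\<close> moves into the second argument of the inner product, by acting on
  \<open>x\<close> with its star, and there the same scalar applies.\<close>

lemma exchange_mod_ideal:
  "embed (ip z x * ip (T y) w - ip (T z) x * ip y w) \<in> I"
proof -
  obtain l where l: "\<And>z g. embed (ip (T z) g) - l *\<^sub>C embed (ip z g) \<in> I"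
    using uniform_scalar_mod_ideal by blast
  have "embed (ip z x) * (embed (ip (T y) w) - l *\<^sub>C embed (ip y w)) \<in> I"
    by (intro I_mem l)
  moreover have "ip z' (act (star (ip y w)) x) = ip z' x * ip y w" for z'
    by (simp add: ip_act_right star_star)
  then have "embed (ip (T z) x * ip y w) - l *\<^sub>C embed (ip z x * ip y w) \<in> I"
    using l[of z "act (star (ip y w)) x"] by simp
  ultimately have "embed (ip z x) * (embed (ip (T y) w) - l *\<^sub>C embed (ip y w))
      - (embed (ip (T z) x * ip y w) - l *\<^sub>C embed (ip z x * ip y w)) \<in> I"
    by (rule I_mem)
  then show ?thesis
    by (simp add: embed_diff embed_mult right_diff_distrib scaleC_mult_right)
qed

end

lemma exchange: "act (ip z x) (T y) = act (ip (T z) x) y"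
proof (rule eqI_ip)
  fix w
  have "ip z x * ip (T y) w - ip (T z) x * ip y w = 0"
    by (intro eq_zero_if_in_maximal_left_ideals exchange_mod_ideal)
  then show "ip (act (ip z x) (T y)) w = ip (act (ip (T z) x) y) w"
    by (simp add: ip_act_left)
qed

end

section \<open>The bounded inverse theorem\<close>

text \<open>By Baire some closure \<open>V n\<close> has interior, so every \<open>y\<close> is
  approximated, with error at most half its norm, by the image of a vector of controlled norm.
  Summing the successive corrections gives the exact preimage.\<close>

lemma bounded_inverse:
  fixes T :: "'x::banach \<Rightarrow> 'y::banach"
  assumes T: "bounded_linear T" and "bij T"
  shows "bounded_linear (inv T)"
proof -
  interpret T: bounded_linear T
    by (rule T)
  define V where "V n = closure (T ` cball 0 (real n))" for n
  have "\<Union>(range V) = UNIV"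
  proof (intro equalityI subset_UNIV subsetI)
    fix y :: 'y
    obtain x where x: "y = T x"
      using \<open>bij T\<close> by (metis bij_pointE)
    obtain n :: nat where "norm x \<le> n"
      using real_arch_simple by blast
    then have "y \<in> V n"
      unfolding V_def x using closure_subset by fastforce
    then show "y \<in> \<Union>(range V)"
      by blast
  qed
  moreover have "euclidean interior_of \<Union>(range V) = {}" if "\<And>n. interior (V n) = {}"
  proof (rule Baire_category_alt)
    show "completely_metrizable_space (euclidean :: 'y topology) \<or>
        locally_compact_space (euclidean :: 'y topology) \<and> regular_space (euclidean :: 'y topology)"
      by (simp add: completely_metrizable_space_euclidean)
    show "closedin euclidean S \<and> euclidean interior_of S = {}" if "S \<in> range V" for S
      using that \<open>\<And>n. interior (V n) = {}\<close> by (auto simp: V_def)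
  qed simp
  ultimately have "\<exists>n. interior (V n) \<noteq> {}"
    by auto
  then obtain n y0 where "y0 \<in> interior (V n)"
    by blast
  then obtain e where e: "e > 0" "ball y0 e \<subseteq> V n"
    by (meson mem_interior)
  \<comment> \<open>A difference of two vectors of norm at most \<open>n\<close>, divided by
    \<open>s = e / (2 * norm y)\<close>, has norm at most
    \<open>2 * n / s = M * norm y\<close>.\<close>
  define M where "M = 4 * real n / e"
  have M: "M \<ge> 0"
    using e by (simp add: M_def)
  have approx: "\<exists>x. norm x \<le> M * norm y \<and> norm (y - T x) \<le> norm y / 2" for y
  proof (cases "y = 0")
    case False
    define s where "s = e / (2 * norm y)"
    have s: "s > 0"
      using False e by (simp add: s_def)
    define d where "d = s * norm y / 4"
    have d: "d > 0"
      using False s by (simp add: d_def)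
    have sy: "norm (s *\<^sub>R y) = e / 2"
      using False e by (simp add: s_def)
    have "y0 + s *\<^sub>R y \<in> V n" "y0 \<in> V n"
      using e sy by (auto intro!: subsetD[OF e(2)] simp: dist_norm)
    then obtain x1 x2 where x: "norm x1 \<le> n" "dist (T x1) (y0 + s *\<^sub>R y) < d"
        "norm x2 \<le> n" "dist (T x2) y0 < d"
      using d unfolding V_def closure_approachable by fastforce
    let ?x = "(1 / s) *\<^sub>R (x1 - x2)"
    have "norm ?x \<le> (1 / s) * (2 * n)"
      using x s norm_triangle_ineq4[of x1 x2] by (simp add: divide_right_mono)
    also have "\<dots> = M * norm y"
      using False by (simp add: M_def s_def)
    finally have 1: "norm ?x \<le> M * norm y" .
    have "s *\<^sub>R (y - T ?x) = (y0 + s *\<^sub>R y - T x1) - (y0 - T x2)"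
      using s by (simp add: T.scaleR T.diff scaleR_diff_right)
    also have "norm \<dots> \<le> d + d"
      using x(2,4) by (intro norm_triangle_le_diff) (simp add: dist_norm norm_minus_commute)
    finally have "s * norm (y - T ?x) \<le> s * (norm y / 2)"
      using s by (simp add: d_def)
    then have "norm (y - T ?x) \<le> norm y / 2"
      using s by simp
    with 1 show ?thesis
      by blast
  qed (auto intro!: exI[of _ 0])
  then obtain f where f: "norm (f y) \<le> M * norm y" "norm (y - T (f y)) \<le> norm y / 2" for y
    by metis
  have "norm (inv T y) \<le> norm y * (2 * M)" for y
  proof -
    \<comment> \<open>The residuals: \<open>r k\<close> is what remains of \<open>y\<close> after
      \<open>k\<close> corrections, and its norm at least halves each time, which yields the factor
      2 in the final bound.\<close>
    define r where "r k = ((\<lambda>z. z - T (f z)) ^^ k) y" for k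
    have r_Suc: "r (Suc k) = r k - T (f (r k))" for k
      by (simp add: r_def)
    have r: "norm (r k) \<le> norm y * (1 / 2) ^ k" for k
    proof (induction k)
      case (Suc k)
      then show ?case
        using f(2)[of "r k"] by (simp add: r_Suc)
    qed (simp add: r_def)
    have fr: "norm (f (r k)) \<le> (M * norm y) * (1 / 2) ^ k" for k
      using f(1)[of "r k"] mult_left_mono[OF r[of k] M] by (simp add: mult_ac)
    have geo: "(\<lambda>k. (M * norm y) * (1 / 2) ^ k) sums ((M * norm y) * 2)"
      using sums_mult[OF geometric_sums[of "1 / 2 :: real"], of "M * norm y"] by simp
    have sn: "summable (\<lambda>k. norm (f (r k)))"
      by (rule summable_comparison_test'[OF sums_summable[OF geo], of 0]) (simp add: fr)
    then have sf: "summable (\<lambda>k. f (r k))"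
      by (rule summable_norm_cancel)
    have "(\<lambda>k. norm y * (1 / 2) ^ k) \<longlonglongrightarrow> norm y * 0"
      by (intro tendsto_mult tendsto_const LIMSEQ_power_zero) simp
    then have "r \<longlonglongrightarrow> 0"
      using r by (intro Lim_null_comparison[of r]) auto
    then have "(\<lambda>k. r 0 - r k) \<longlonglongrightarrow> r 0 - 0"
      by (intro tendsto_diff tendsto_const)
    moreover have "(\<Sum>j<k. T (f (r j))) = r 0 - r k" for k
      by (induction k) (simp_all add: r_Suc)
    ultimately have "(\<lambda>k. T (f (r k))) sums r 0"
      by (simp add: sums_def)
    then have "T (\<Sum>k. f (r k)) = y"
      using T.sums[OF summable_sums[OF sf]] by (simp add: sums_unique2 r_def)
    then have "inv T y = (\<Sum>k. f (r k))"
      using \<open>bij T\<close> by (metis bij_inv_eq_iff)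
    also have "norm \<dots> \<le> (\<Sum>k. norm (f (r k)))"
      by (rule summable_norm[OF sn])
    also have "\<dots> \<le> (\<Sum>k. (M * norm y) * (1 / 2) ^ k)"
      by (rule suminf_le[OF fr sn sums_summable[OF geo]])
    also have "\<dots> = norm y * (2 * M)"
      using sums_unique[OF geo] by (simp add: mult_ac)
    finally show ?thesis .
  qed
  note bound = this
  have inv: "inv T y = x \<longleftrightarrow> y = T x" and T_inv: "T (inv T y) = y" for x y
    using \<open>bij T\<close> by (metis bij_inv_eq_iff)+
  show ?thesis
    by (rule bounded_linear_intro[OF _ _ bound]) (simp_all add: inv T_inv T.add T.scaleR)
qed

section \<open>Central multipliers\<close>

lemma multiplier_eqI:
  assumes "\<And>a. lmult m a = lmult n a" "\<And>a. rmult m a = rmult n a"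
  shows "m = n"
  using assms by transfer (auto simp: prod_eq_iff)

lemma lmult_mult: "lmult m (a * b) = lmult m a * b"
  and rmult_mult: "rmult m (a * b) = a * rmult m b"
  by (transfer; auto simp: double_centralizer_def)+

lemma lmult_times [simp]: "lmult (m * n) a = lmult m (lmult n a)"
  and rmult_times [simp]: "rmult (m * n) a = rmult n (rmult m a)"
  by (transfer; auto)+

lemma lmult_one [simp]: "lmult 1 a = a"
  and rmult_one [simp]: "rmult 1 a = a"
  by (transfer; simp)+

lemma eqI_mult_right:
  fixes a b :: "'a::cstar_algebra"
  assumes "\<And>c. a * c = b * c"
  shows "a = b"
  using eq_zero_if_annihilates[of "a - b"] assms by (simp add: left_diff_distrib)

lemma eqI_mult_left:
  fixes a b :: "'a::cstar_algebra"
  assumes "\<And>c. c * a = c * b"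
  shows "a = b"
proof -
  have "star a * star c = star b * star c" for c
    by (simp only: assms star_mult[symmetric])
  from this[of "star _", unfolded star_star] have "star a = star b"
    by (rule eqI_mult_right)
  then show ?thesis
    using star_star by metis
qed

text \<open>The hypothesis says that \<open>d\<close> commutes with \<open>A\<close>. Commutation
  with an arbitrary multiplier is tested after multiplication by a further element \<open>c\<close>
  of \<open>A\<close>, where \<open>swap\<close> lets \<open>d\<close> pass from one factor to the
  other.\<close>

lemma multiplier_centerI:
  assumes "rmult d = lmult d"
  shows "d \<in> multiplier_center"
  unfolding multiplier_center_def
proof (intro CollectI allI multiplier_eqI)
  have swap: "lmult d a * b = a * lmult d b" for a b
    using lmult_mult[of d a b] rmult_mult[of d a b] by (simp add: assms)
  fix m a
  show "lmult (d * m) a = lmult (m * d) a"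
  proof (rule eqI_mult_right)
    fix c
    have "lmult d (lmult m a) * c = lmult m (a * lmult d c)"
      by (simp only: swap lmult_mult)
    also have "\<dots> = lmult m (lmult d a) * c"
      by (simp only: lmult_mult flip: swap)
    finally show "lmult (d * m) a * c = lmult (m * d) a * c"
      by simp
  qed
  show "rmult (d * m) a = rmult (m * d) a"
  proof (rule eqI_mult_left)
    fix c
    have "c * rmult m (lmult d a) = rmult m (lmult d c * a)"
      by (simp only: swap rmult_mult)
    also have "\<dots> = c * lmult d (rmult m a)"
      unfolding rmult_mult by (simp only: swap)
    finally show "c * rmult (d * m) a = c * rmult (m * d) a"
      by (simp add: assms)
  qed
qed

section \<open>The multiplier that implements a morphism\<close>

context hilbert_module
begin

text \<open>A spectral radius argument: with \<open>h = c\<^sup>* c\<close> and \<open>b = c\<^sup>* a\<close> one has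
  \<open>h\<^sup>n y = b\<^sup>n T\<^sup>n y\<close>, and the norms of the powers of \<open>h\<close> can be tested on a single finite sum of
  inner products close to \<open>h\<close>.\<close>

lemma norm_multiplier_le:
  assumes full: "full_ip ip"
    and T: "\<And>a x. T (act a x) = act a (T x)" "\<And>x. norm (T x) \<le> K * norm x" "K \<ge> 0"
    and ac: "\<And>y. act a (T y) = act c y"
  shows "norm c \<le> K * norm a"
proof -
  define h b where "h = star c * c" and "b = star c * a"
  have h: "star h = h"
    by (simp add: h_def star_mult star_star)
  have hb: "act h y = act b (T y)" for y
    by (simp add: h_def b_def act_mult ac)
  have pow: "uact (embed h ^ n) y = uact (embed b ^ n) ((T ^^ n) y)" for n y
  proof (induction n arbitrary: y)
    case (Suc n)
    have "uact (embed h ^ Suc n) y = uact (embed h ^ n) (act b (T y))"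
      by (simp only: power_Suc2 uact_mult uact_embed hb)
    also have "\<dots> = uact (embed b ^ n) ((T ^^ n) (act b (T y)))"
      by (rule Suc.IH)
    also have "(T ^^ n) (act b (T y)) = act b ((T ^^ Suc n) y)"
    proof -
      have "(T ^^ k) (act b z) = act b ((T ^^ k) z)" for k z
        by (induction k) (simp_all add: T)
      then show ?thesis
        by (simp add: funpow_swap1)
    qed
    finally show ?case
      by (simp only: power_Suc2 uact_mult uact_embed)
  qed simp
  define s where "s = norm b * K"
  have s: "s \<ge> 0"
    using T by (simp add: s_def)
  have normT: "norm ((T ^^ n) y) \<le> K ^ n * norm y" for n y
  proof (induction n)
    case (Suc n)
    have "norm (T ((T ^^ n) y)) \<le> K * (K ^ n * norm y)"
      by (rule order_trans[OF T(2) mult_left_mono[OF Suc.IH T(3)]])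
    then show ?case
      by (simp add: mult_ac)
  qed simp
  have norm_pow: "norm (uact (embed h ^ n) y) \<le> s ^ n * norm y" for n y
  proof -
    have "norm (uact (embed h ^ n) y) \<le> norm (embed b ^ n) * norm ((T ^^ n) y)"
      unfolding pow by (rule norm_uact_le)
    also have "\<dots> \<le> norm b ^ n * (K ^ n * norm y)"
      using norm_power_ineq[of "embed b" n] normT by (intro mult_mono) auto
    finally show ?thesis
      by (simp add: s_def power_mult_distrib mult_ac)
  qed
  \<comment> \<open>The constant \<open>M\<close> may depend on \<open>e\<close>, so
    \<open>E\<close> is a subspace that need not be closed; its density is enough.\<close>
  define E where "E = {e. \<exists>M\<ge>0. \<forall>n. norm (embed h ^ n * embed e) \<le> M * s ^ n}"
  have "ip y w \<in> E" for y w
  proof -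
    have "norm (embed h ^ n * embed (ip y w)) \<le> (4 * norm y * norm w) * s ^ n" for n
    proof -
      have "norm (embed h ^ n * embed (ip y w)) = norm (ip (uact (embed h ^ n) y) w)"
        by (simp flip: embed_ip_uact_left)
      also have "\<dots> \<le> 4 * norm (uact (embed h ^ n) y) * norm w"
        by (rule norm_ip_le)
      also have "\<dots> \<le> 4 * (s ^ n * norm y) * norm w"
        by (intro mult_right_mono mult_left_mono norm_pow) auto
      finally show ?thesis
        by (simp add: mult_ac)
    qed
    then show ?thesis
      unfolding E_def by (intro CollectI exI[of _ "4 * norm y * norm w"]) auto
  qed
  moreover have "complex_vector.subspace E"
    unfolding complex_vector.subspace_def
  proof (intro conjI ballI allI)
    show "0 \<in> E"
      by (auto simp: E_def intro!: exI[of _ 0])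
  next
    fix e f assume "e \<in> E" "f \<in> E"
    then obtain M N where M: "M \<ge> 0" "\<And>n. norm (embed h ^ n * embed e) \<le> M * s ^ n"
      and N: "N \<ge> 0" "\<And>n. norm (embed h ^ n * embed f) \<le> N * s ^ n"
      unfolding E_def by blast
    have "norm (embed h ^ n * embed (e + f)) \<le> (M + N) * s ^ n" for n
      unfolding embed_add distrib_left distrib_right by (intro norm_triangle_mono M N)
    then show "e + f \<in> E"
      using M(1) N(1) unfolding E_def by (intro CollectI exI[of _ "M + N"]) auto
  next
    fix k e assume "e \<in> E"
    then obtain M where M: "M \<ge> 0" "\<And>n. norm (embed h ^ n * embed e) \<le> M * s ^ n"
      unfolding E_def by blast
    have "norm (embed h ^ n * embed (k *\<^sub>C e)) \<le> (cmod k * M) * s ^ n" for n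
      using mult_left_mono[OF M(2)[of n], of "cmod k"]
      by (simp add: embed_scaleC scaleC_mult_right norm_scaleC mult_ac)
    then show "k *\<^sub>C e \<in> E"
      using M(1) unfolding E_def by (intro CollectI exI[of _ "cmod k * M"]) auto
  qed
  ultimately have "complex_vector.span {ip x y | x y. True} \<subseteq> E"
    by (intro complex_vector.span_minimal) auto
  then have E: "closure E = UNIV"
    using full closure_mono[of _ E] unfolding full_ip_def by blast
  have hs: "norm h \<le> s"
  proof (rule ccontr)
    assume "\<not> norm h \<le> s"
    then have hpos: "norm h > s" "norm h > 0"
      using s by auto
    have "h \<in> closure E"
      by (simp add: E)
    then obtain e where e: "e \<in> E" "dist e h < norm h / 2"
      using hpos unfolding closure_approachable by (meson half_gt_zero)
    then obtain M where M: "M \<ge> 0" "\<And>n. norm (embed h ^ n * embed e) \<le> M * s ^ n"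
      unfolding E_def by blast
    \<comment> \<open>Splitting \<open>h\<close> as \<open>e + (h - e)\<close>, the second part
      absorbs at most half of \<open>norm h ^ Suc n\<close>. The first part must carry the rest, yet
      it grows only like \<open>s ^ n\<close>.\<close>
    have "norm h / 2 \<le> M * (s / norm h) ^ n" for n
    proof -
      have "norm h ^ n * norm h = norm (embed h ^ n * embed e + embed h ^ n * embed (h - e))"
        using norm_embed_power_selfadjoint[OF h, of "Suc n"]
        by (simp add: embed_diff power_commutes mult.commute flip: distrib_left)
      also have "\<dots> \<le> M * s ^ n + norm h ^ n * (norm h / 2)"
      proof (intro norm_triangle_mono M)
        have "norm (embed h ^ n * embed (h - e)) \<le> norm (embed h ^ n) * norm (embed (h - e))"
          by (rule norm_mult_ineq)
        also have "\<dots> \<le> norm h ^ n * (norm h / 2)"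
          unfolding norm_embed norm_embed_power_selfadjoint[OF h] using e(2)
          by (intro mult_left_mono) (simp_all add: dist_norm norm_minus_commute)
        finally show "norm (embed h ^ n * embed (h - e)) \<le> norm h ^ n * (norm h / 2)" .
      qed
      finally show ?thesis
        using hpos by (simp add: power_divide field_simps)
    qed
    moreover have "(\<lambda>n. M * (s / norm h) ^ n) \<longlonglongrightarrow> M * 0"
      using hpos s by (intro tendsto_mult tendsto_const LIMSEQ_power_zero) auto
    ultimately have "norm h / 2 \<le> M * 0"
      by (intro LIMSEQ_le_const[of _ "M * 0"]) auto
    then show False
      using hpos by simp
  qed
  have "norm c * norm c = norm h"
    by (simp add: h_def cstar_identity power2_eq_square)
  also have "\<dots> \<le> norm (star c) * norm a * K"
    using hs norm_mult_ineq[of "star c" a] T(3) unfolding s_def b_def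
    by (meson mult_right_mono order_trans)
  finally show ?thesis
    by (cases "c = 0") (simp_all add: T(3) mult_ac)
qed

text \<open>The relation \<open>P\<close> is the graph of the multiplier to be found. The norm bound
  makes it single-valued and its domain \<open>A\<close> closed; the exchange identity puts all
  inner products into the domain, so by fullness it is everything. The resulting \<open>L\<close> is
  linear over the algebra on both sides and serves as both components of the double
  centralizer.\<close>

lemma central_multiplier_exists:
  assumes full: "full_ip ip"
    and T: "bounded_module_morphism act T"
    and exchange: "\<And>x y z. act (ip z x) (T y) = act (ip (T z) x) y"
  shows "\<exists>d. rmult d = lmult d \<and> (\<forall>a y. act a (T y) = act (lmult d a) y)"
proof -
  have T_act: "T (act a x) = act a (T x)" for a x
    using T by (simp add: bounded_module_morphism_def)
  have "bounded_linear T"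
    using T by (simp add: bounded_module_morphism_def bounded_clinear_def)
  then obtain K where K: "K \<ge> 0" "\<And>x. norm (T x) \<le> K * norm x"
    using bounded_linear.nonneg_bounded by (metis mult.commute)
  note bound = norm_multiplier_le[OF full T_act K(2,1)]
  define P where "P a c \<longleftrightarrow> (\<forall>y. act a (T y) = act c y)" for a c
  have P_bound: "norm c \<le> K * norm a" if "P a c" for a c
    using bound that unfolding P_def by blast
  have P_add: "P (a + b) (c + d)" if "P a c" "P b d" for a b c d
    using that by (simp add: P_def act_add_left)
  have P_scaleC: "P (k *\<^sub>C a) (k *\<^sub>C c)" if "P a c" for k a c
    using that by (simp add: P_def act_scaleC_left)
  have P_diff: "P (a - b) (c - d)" if "P a c" "P b d" for a b c d
    using that by (simp add: P_def act_diff_left)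
  have P_unique: "c = d" if "P a c" "P a d" for a c d
    using P_bound[OF P_diff[OF that]] by simp
  define A where "A = {a. \<exists>c. P a c}"
  have "complex_vector.subspace A"
  proof -
    have "P 0 0"
      by (simp add: P_def)
    then show ?thesis
      unfolding complex_vector.subspace_def A_def using P_add P_scaleC by blast
  qed
  moreover have "{ip x y | x y. True} \<subseteq> A"
    using exchange by (auto simp: A_def P_def)
  ultimately have "complex_vector.span {ip x y | x y. True} \<subseteq> A"
    by (intro complex_vector.span_minimal)
  moreover have "closed A"
    unfolding closed_sequential_limits
  proof (intro allI impI, elim conjE)
    fix X a assume "\<forall>n. X n \<in> A" and X: "X \<longlonglongrightarrow> a"
    then obtain C where C: "P (X n) (C n)" for n
      unfolding A_def mem_Collect_eq by metis
    have "Cauchy C"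
    proof (rule CauchyI)
      fix e :: real assume "e > 0"
      then have "e / (K + 1) > 0"
        using K by simp
      then obtain N where N: "\<And>m n. m \<ge> N \<Longrightarrow> n \<ge> N \<Longrightarrow> norm (X m - X n) < e / (K + 1)"
        using CauchyD[OF LIMSEQ_imp_Cauchy[OF X]] by blast
      have "norm (C m - C n) < e" if "m \<ge> N" "n \<ge> N" for m n
      proof -
        have "norm (C m - C n) \<le> K * norm (X m - X n)"
          by (rule P_bound[OF P_diff[OF C C]])
        also have "\<dots> \<le> (K + 1) * norm (X m - X n)"
          by (intro mult_right_mono) auto
        also have "\<dots> < e"
          using N[OF that] K by (simp add: field_simps)
        finally show ?thesis .
      qed
      then show "\<exists>N. \<forall>m\<ge>N. \<forall>n\<ge>N. norm (C m - C n) < e"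
        by blast
    qed
    then obtain c where c: "C \<longlonglongrightarrow> c"
      using Cauchy_convergent convergent_def by blast
    have "act a (T y) = act c y" for y
    proof (rule LIMSEQ_unique)
      show "(\<lambda>n. act (X n) (T y)) \<longlonglongrightarrow> act a (T y)"
        by (rule bounded_linear.tendsto[OF bounded_linear_act_left X])
      show "(\<lambda>n. act (X n) (T y)) \<longlonglongrightarrow> act c y"
        using bounded_linear.tendsto[OF bounded_linear_act_left c, of y] C by (simp add: P_def)
    qed
    then show "a \<in> A"
      by (auto simp: A_def P_def)
  qed
  ultimately have "A = UNIV"
    using closure_minimal[of _ A] full unfolding full_ip_def by blast
  then have "\<forall>a. \<exists>c. P a c"
    by (auto simp: A_def)
  then obtain L where L: "P a (L a)" for a
    using choice[of P] by blast
  have L_scaleC: "L (k *\<^sub>C a) = k *\<^sub>C L a" for k a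
    by (rule P_unique[OF L P_scaleC[OF L]])
  have "bounded_linear L"
  proof (rule bounded_linear_intro)
    show "L (a + b) = L a + L b" for a b
      by (rule P_unique[OF L P_add[OF L L]])
    show "L (r *\<^sub>R a) = r *\<^sub>R L a" for r a
      using L_scaleC[of "complex_of_real r" a] by (simp only: scaleC_of_real)
    show "norm (L a) \<le> norm a * K" for a
      using P_bound[OF L, of a] by (simp add: mult.commute)
  qed
  then have "bounded_clinear L"
    by (simp add: bounded_clinear_def L_scaleC)
  moreover have L_right: "L (a * b) = L a * b" for a b
    by (rule P_unique[OF L]) (use L in \<open>simp add: P_def act_mult flip: T_act\<close>)
  moreover have L_left: "L (a * b) = a * L b" for a b
    by (rule P_unique[OF L]) (use L[of b] in \<open>simp add: P_def act_mult\<close>)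
  moreover have "a * L b = L a * b" for a b
    by (simp flip: L_left L_right)
  ultimately have "double_centralizer L L"
    by (simp add: double_centralizer_def)
  then have "lmult (Abs_multiplier (L, L)) = L" "rmult (Abs_multiplier (L, L)) = L"
    by (simp_all add: lmult.rep_eq rmult.rep_eq Abs_multiplier_inverse)
  then show ?thesis
    using L by (intro exI[of _ "Abs_multiplier (L, L)"]) (simp add: P_def)
qed

text \<open>Two candidates agree on the vectors \<open>act u x\<close>, which approximate
  \<open>x\<close> itself by \<open>act_approximates\<close>. This resolves the definite
  description.\<close>

lemma multiplier_act_eqI:
  assumes S: "bounded_clinear S" "\<And>a x. S (act a x) = act (lmult m a) x"
  shows "multiplier_act act m = S"
  unfolding multiplier_act_def
proof (rule the_equality)
  fix S' assume S': "bounded_clinear S' \<and> (\<forall>a x. S' (act a x) = act (lmult m a) x)"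
  show "S' = S"
  proof
    fix x
    have D: "bounded_linear (\<lambda>x. S' x - S x)"
      using S S' by (simp add: bounded_clinear_def bounded_linear_sub)
    have "closed {x. S' x - S x = 0}"
      by (intro closed_Collect_eq linear_continuous_on D continuous_on_const)
    moreover have "x \<in> closure {x. S' x - S x = 0}"
      unfolding closure_approachable
    proof (intro allI impI)
      fix e :: real assume "e > 0"
      then obtain u where "norm (x - act u x) < e"
        using act_approximates by blast
      then show "\<exists>y\<in>{x. S' x - S x = 0}. dist y x < e"
        using S S' by (intro bexI[of _ "act u x"]) (auto simp: dist_norm norm_minus_commute)
    qed
    ultimately show "S' x = S x"
      by simp
  qed
qed (use S in simp)

end

theorem theorem1p2:
  fixes act :: "'a::cstar_algebra \<Rightarrow> 'x::{complex_normed_vector, banach} \<Rightarrow> 'x"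
    and ip :: "'x \<Rightarrow> 'x \<Rightarrow> 'a"
    and T :: "'x \<Rightarrow> 'x"
  assumes "hilbert_module act ip"
    and "full_ip ip"
    and "bounded_module_morphism act T"
    and "bij T"
    and "\<And>Y. is_submodule act Y \<Longrightarrow> closed Y \<Longrightarrow> T ` Y \<subseteq> Y"
  shows "\<exists>d\<in>multiplier_center. (\<exists>e\<in>multiplier_center. d * e = 1 \<and> e * d = 1) \<and>
           (\<forall>x. T x = multiplier_act act d x)"
proof -
  interpret hilbert_module act ip
    by fact
  interpret local_morphism act ip T
    by unfold_locales (use assms in auto)
  define S where "S = inv T"
  have ST: "S (T x) = x" "T (S x) = x" for x
    unfolding S_def using \<open>bij T\<close> by (simp_all add: bij_is_inj bij_is_surj surj_f_inv_f)
  have eq_iff: "S x = y \<longleftrightarrow> x = T y" for x y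
    using ST by metis
  have S_act: "S (act a x) = act a (S x)" and S_scaleC: "S (c *\<^sub>C x) = c *\<^sub>C S x" for a x c
    by (simp_all add: eq_iff T_simps ST)
  have T_clinear: "bounded_clinear T"
    using morphism by (simp add: bounded_module_morphism_def)
  then have "bounded_linear S"
    unfolding S_def bounded_clinear_def by (intro bounded_inverse \<open>bij T\<close>) simp
  then have S: "bounded_module_morphism act S"
    by (simp add: bounded_module_morphism_def bounded_clinear_def S_act S_scaleC)
  \<comment> \<open>The identity for \<open>T\<close> at \<open>S z\<close> and \<open>S y\<close>,
    read from right to left.\<close>
  have S_exchange: "act (ip z x) (S y) = act (ip (S z) x) y" for x y z
    using exchange[of "S z" x "S y"] by (simp add: ST)
  obtain d where d: "rmult d = lmult d" "\<And>a y. act a (T y) = act (lmult d a) y"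
    using central_multiplier_exists[OF \<open>full_ip ip\<close> morphism exchange] by blast
  obtain e where e: "rmult e = lmult e" "\<And>a y. act a (S y) = act (lmult e a) y"
    using central_multiplier_exists[OF \<open>full_ip ip\<close> S S_exchange] by blast
  \<comment> \<open>The norm bound for the identity morphism with \<open>K = 1\<close>, comparing
    \<open>a - b\<close> with 0.\<close>
  have faithful: "a = b" if "\<And>y. act a y = act b y" for a b
  proof -
    have "norm (a - b) \<le> 1 * norm (0 :: 'a)"
      by (rule norm_multiplier_le[OF \<open>full_ip ip\<close>, of "\<lambda>x. x"]) (simp_all add: act_diff_left that)
    then show ?thesis
      by simp
  qed
  \<comment> \<open>Both sides act equally on \<open>X\<close>: the two multipliers turn into
    \<open>T\<close> and \<open>S\<close> on the vector, and these cancel.\<close>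
  have de: "lmult d (lmult e a) = a" "lmult e (lmult d a) = a" for a
    by (rule faithful; simp add: ST flip: d(2) e(2))+
  have "d * e = 1" "e * d = 1"
    by (rule multiplier_eqI; simp add: d(1) e(1) de)+
  moreover have "multiplier_act act d = T"
    by (intro multiplier_act_eqI T_clinear) (simp add: T_simps d(2))
  ultimately show ?thesis
    using multiplier_centerI d(1) e(1) by metis
qed

end
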